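(* For all positive integers $n$ and all odd positive integers $k$, the equality $$\sum_{r=0}^{2n} \binom{2n}{r} x_k(r)\,x_k(2n-r) = \sum_{r=0}^{2n} (-1)^r \binom{2n}{r}\, y_k(r)\,y_k(2n-r)$$ holds.
   Context: For a nonnegative integer $r$, let $[r]=\{1,2,\dots,r\}$. An involution of length $r$ is a permutation $v$ of $[r]$ with $v\circ v=\mathrm{id}$ (the identity is included), so all its cycles have length one (fixed points) or two. A decreasing subsequence of $v$ is a subsequence of the word $v(1)v(2)\cdots v(r)$ whose entries are strictly decreasing. $y_k(r)$ denotes the number of Standard Young Tableaux on $r$ boxes that have no rows longer than $k$; equivalently (by the Robinson-Schensted correspondence and conjugation of tableaux), the number of involutions of length $r$ with no decreasing subsequence of more than $k$ elements. $x_k(r)$ denotes the number of fixed point-free involutions of length $r$ with no decreasing subsequence of more than $k$ elements. (In particular $x_k(r)=0$ if $r$ is odd.) The empty tableau and the empty involution are counted, so $y_k(0)=x_k(0)=1$. *)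

theory Defs
  imports "HOL-Combinatorics.Permutations" "HOL-Library.Sublist"
begin

text \<open>A tableau is given by the list of its rows, from top to bottom (English notation). Empty rows
  are excluded, so that distinct lists are distinct tableaux.\<close>

definition standard_young_tableau :: "nat \<Rightarrow> nat list list \<Rightarrow> bool" where
  "standard_young_tableau r t \<longleftrightarrow>
     [] \<notin> set t \<and>
     sorted_wrt (\<ge>) (map length t) \<and>
     distinct (concat t) \<and> set (concat t) = {1..r} \<and>
     (\<forall>row \<in> set t. sorted_wrt (<) row) \<and>
     (\<forall>i j. Suc i < length t \<and> j < length (t ! Suc i) \<longrightarrow> t ! i ! j < t ! Suc i ! j)"

definition y_num :: "nat \<Rightarrow> nat \<Rightarrow> nat" where
  "y_num k r = card {t. standard_young_tableau r t \<and> (\<forall>row \<in> set t. length row \<le> k)}"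

definition involution :: "nat \<Rightarrow> (nat \<Rightarrow> nat) \<Rightarrow> bool" where
  "involution r v \<longleftrightarrow> v permutes {1..r} \<and> v \<circ> v = id"

definition fixed_point_free :: "nat \<Rightarrow> (nat \<Rightarrow> nat) \<Rightarrow> bool" where
  "fixed_point_free r v \<longleftrightarrow> (\<forall>i \<in> {1..r}. v i \<noteq> i)"

definition word :: "nat \<Rightarrow> (nat \<Rightarrow> nat) \<Rightarrow> nat list" where
  "word r v = map v [1..<Suc r]"

definition decreasing_subsequence :: "nat list \<Rightarrow> nat \<Rightarrow> (nat \<Rightarrow> nat) \<Rightarrow> bool" where
  "decreasing_subsequence s r v \<longleftrightarrow> subseq s (word r v) \<and> sorted_wrt (>) s"

definition x_num :: "nat \<Rightarrow> nat \<Rightarrow> nat" where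
  "x_num k r = card {v. involution r v \<and> fixed_point_free r v \<and>
                        (\<forall>s. decreasing_subsequence s r v \<longrightarrow> length s \<le> k)}"

text \<open>The sets counted by \<^const>\<open>y_num\<close> and \<^const>\<open>x_num\<close> are finite, so \<^const>\<open>card\<close> is never the
  default value for infinite sets.\<close>

lemma finite_standard_young_tableaux: "finite {t. standard_young_tableau r t}"
proof -
  let ?R = "{row. set row \<subseteq> {1..r} \<and> length row \<le> r}"
  have "{t. standard_young_tableau r t} \<subseteq> {t. set t \<subseteq> ?R \<and> length t \<le> r}"
  proof
    fix t assume "t \<in> {t. standard_young_tableau r t}"
    then have t: "standard_young_tableau r t" by simp
    have len: "length (concat t) = r"
      using t distinct_card[of "concat t"] by (simp add: standard_young_tableau_def)
    have rows: "set t \<subseteq> ?R"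
    proof
      fix row assume row: "row \<in> set t"
      have "set row \<subseteq> {1..r}"
        using t row by (auto simp: standard_young_tableau_def)
      moreover have "length row \<le> length (concat t)"
        using row by (simp add: length_concat member_le_sum_list)
      ultimately show "row \<in> ?R" using len by simp
    qed
    have "[] \<notin> set t" using t by (simp add: standard_young_tableau_def)
    then have "length t \<le> length (concat t)"
    proof (induction t)
      case (Cons row t)
      then show ?case by (cases row) auto
    qed simp
    with rows len show "t \<in> {t. set t \<subseteq> ?R \<and> length t \<le> r}" by simp
  qed
  moreover have "finite {t. set t \<subseteq> ?R \<and> length t \<le> r}"
    by (intro finite_lists_length_le) auto
  ultimately show ?thesis
    by (rule finite_subset)
qed

lemma finite_involutions: "finite {v. involution r v}"
  by (rule finite_subset[OF _ finite_permutations[of "{1..r}"]]) (auto simp: involution_def)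

lemma y_num_0: "y_num k 0 = 1"
proof -
  have "t = []" if "standard_young_tableau 0 t" for t
    using that by (cases t) (auto simp: standard_young_tableau_def)
  then have "{t. standard_young_tableau 0 t \<and> (\<forall>row \<in> set t. length row \<le> k)} = {[]}"
    by (auto simp: standard_young_tableau_def)
  then show ?thesis by (simp add: y_num_def)
qed

lemma x_num_0: "x_num k 0 = 1"
proof -
  have "s = []" if "decreasing_subsequence s 0 v" for s v
    using that list_emb_Nil2[of "(=)" s] by (simp add: decreasing_subsequence_def word_def)
  then have "\<forall>s. decreasing_subsequence s 0 v \<longrightarrow> length s \<le> k" for v
    by (metis le0 list.size(3))
  then have "{v. involution 0 v \<and> fixed_point_free 0 v \<and>
            (\<forall>s. decreasing_subsequence s 0 v \<longrightarrow> length s \<le> k)} = {id}"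
    by (simp add: involution_def fixed_point_free_def set_eq_iff) (metis comp_id)
  then show ?thesis by (simp add: x_num_def)
qed

end

theory Submission
  imports Defs "HOL-Computational_Algebra.Formal_Power_Series" "HOL-Library.Infinite_Set"
begin

text \<open>
Let \<open>X(z)\<close> and \<open>Y(z)\<close> be the exponential generating functions of the sequences \<open>x_num k\<close> and
\<open>y_num k\<close>. For odd \<open>k\<close> they satisfy \<open>Y(z) = exp z * X(z)\<close>, and \<open>X\<close> is even because a
fixed point-free involution has even length. Hence
\<open>Y(- z) * Y(z) = exp (- z) * X(z) * exp z * X(z) = X(z) * X(z)\<close>, and comparing coefficients
(\<open>alternating_convolution_of_binomial_transform\<close>) gives the claim.

The relation between \<open>X\<close> and \<open>Y\<close> says that an involution without decreasing subsequences of more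
than \<open>k\<close> elements is an arbitrary set of fixed points together with a fixed point-free involution of
the same kind. The graph of an involution is symmetric about the diagonal. A decreasing subsequence
contains at most one fixed point, and its larger half, on one side of the diagonal, can be mirrored.
So if removing the fixed points leaves decreasing subsequences of at most \<open>2 * m + 1\<close> elements, each
half has at most \<open>m\<close> elements, and the whole has at most \<open>2 * m + 1\<close>
(\<open>falling_bound_remove_fixed_points\<close>).

As \<open>y_num\<close> counts tableaux, this needs the Robinson-Schensted correspondence between involutions and
standard tableaux, and the fact that the number of rows is the length of a longest decreasing
subsequence; transposing tableaux turns the bound on rows into one on columns. Viennot's shadow
lines give both, without insertion and without comparing the two tableaux of a permutation. Rays going
up and right from the points of the graph annihilate each other in pairs, and the places where they
meet form the skeleton, again the graph of an involution, on a smaller set. The columns whose rays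
survive form the first row of the tableau, and the skeleton yields the other rows. Three facts
suffice. Passing to the skeleton shortens the longest decreasing chain by exactly one
(\<open>falling_bound_skeleton\<close>). The first row and the skeleton determine the involution
(\<open>skeleton_lead_row_inject\<close>). Every first row that fits on top of that of the skeleton occurs
(\<open>skeleton_lead_row_surj\<close>). The last two hold since the rays are the jumps of a function on the
grid that obeys a local rule, and the rule can be run backwards.\<close>

section \<open>Growth and skeleton\<close>

text \<open>An involution on \<open>A\<close> is represented by its graph: as a set of points in the plane it can lose
rows and columns without renumbering, which is what the passage to skeletons needs. Coordinates are
positive, so that the axes can serve as the empty boundary of the growth function.\<close>

definition partial_involution :: "nat set \<Rightarrow> (nat \<times> nat) set \<Rightarrow> bool" where
  "partial_involution A X \<longleftrightarrow> finite A \<and> 0 \<notin> A \<and> sym X \<and> single_valued X \<and> Domain X = A"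

text \<open>The largest number of points of \<open>X\<close> on a strictly increasing chain inside
\<open>{1..a} \<times> {1..b}\<close>, given by Fomin's local rule for the first part of a growth diagram
rather than as a maximum.\<close>

fun growth :: "(nat \<times> nat) set \<Rightarrow> nat \<Rightarrow> nat \<Rightarrow> int" where
  "growth X 0 b = 0"
| "growth X (Suc a) 0 = 0"
| "growth X (Suc a) (Suc b) =
     (if (Suc a, Suc b) \<in> X then growth X a b + 1
      else max (growth X a (Suc b)) (growth X (Suc a) b))"

text \<open>Viennot's skeleton. From every point of \<open>X\<close> a vertical ray goes up and a horizontal ray goes
right; where a vertical and a horizontal ray meet, both stop, and the place where they meet is a
point of the skeleton. The rays are the lines across which \<^const>\<open>growth\<close> jumps by one.\<close>

definition skeleton :: "(nat \<times> nat) set \<Rightarrow> (nat \<times> nat) set" where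
  "skeleton X = {(Suc a, Suc b) | a b. (Suc a, Suc b) \<notin> X \<and>
     growth X a b < growth X (Suc a) b \<and> growth X a b < growth X a (Suc b)}"

text \<open>The vertical ray in column \<open>a\<close> is present at height \<open>b\<close>: it has started at a point of
\<open>X\<close> and has not yet stopped at a point of the skeleton. By symmetry, \<open>lit X b a\<close> speaks of
the horizontal ray in row \<open>b\<close>.\<close>

definition lit :: "(nat \<times> nat) set \<Rightarrow> nat \<Rightarrow> nat \<Rightarrow> bool" where
  "lit X a b \<longleftrightarrow> (\<exists>d\<le>b. (a, d) \<in> X) \<and> \<not> (\<exists>d\<le>b. (a, d) \<in> skeleton X)"

lemma growth_0_right [simp]: "growth X a 0 = 0"
  by (cases a) auto

lemma growth_sym:
  assumes "sym X"
  shows "growth X a b = growth X b a"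
proof -
  have "(Suc a, Suc b) \<in> X \<longleftrightarrow> (Suc b, Suc a) \<in> X" for a b
    using assms by (auto dest: symD)
  then show ?thesis
    by (induction X a b rule: growth.induct) (auto simp: max.commute)
qed

lemma sym_skeleton:
  assumes "sym X"
  shows "sym (skeleton X)"
proof (rule symI)
  fix a b assume "(a, b) \<in> skeleton X"
  then show "(b, a) \<in> skeleton X"
    unfolding skeleton_def using assms growth_sym[OF assms] by (auto dest: symD)
qed

lemma partial_involution_pos:
  assumes "partial_involution A X" "(a, b) \<in> X"
  shows "a \<in> A" "b \<in> A" "0 < a" "0 < b"
proof -
  show "a \<in> A" "b \<in> A"
    using assms by (auto simp: partial_involution_def dest: symD)
  then show "0 < a" "0 < b"
    using assms by (auto simp: partial_involution_def intro!: gr0I)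
qed

lemma partial_involution_fun:
  assumes "partial_involution A X"
  shows "(a, b) \<in> X \<Longrightarrow> (a, c) \<in> X \<Longrightarrow> b = c"
    and "(b, a) \<in> X \<Longrightarrow> (c, a) \<in> X \<Longrightarrow> b = c"
    and "(a, b) \<in> X \<Longrightarrow> (b, a) \<in> X"
  using assms by (auto simp: partial_involution_def dest: symD single_valuedD)

text \<open>The rays are exactly the unit jumps of \<^const>\<open>growth\<close>. In the unit square with upper right corner
\<open>(a, b)\<close>, the jumps entering from below and from the left determine those leaving: two entering
jumps cancel (a skeleton point), one entering jump passes through, and if none enters, two leave
exactly at a point of \<open>X\<close>.\<close>

lemma growth_step:
  assumes X: "partial_involution A X"
  shows "growth X (Suc a) b - growth X a b = of_bool (lit X (Suc a) b)"
proof (induction "a + b" arbitrary: a b rule: less_induct)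
  case less
  note fn = partial_involution_fun[OF X]
  have sX: "sym X" using X by (simp add: partial_involution_def)
  show ?case
  proof (cases b)
    case 0
    have "\<not> lit X (Suc a) 0"
      using partial_involution_pos(4)[OF X, of "Suc a" 0] by (auto simp: lit_def)
    then show ?thesis using 0 by simp
  next
    case (Suc c)
    \<comment> \<open>The two jumps that enter the square from below and from the left; the second is an instance of the
      induction hypothesis for the transposed square.\<close>
    have h: "growth X (Suc a) c - growth X a c = of_bool (lit X (Suc a) c)"
      using less Suc by simp
    have v: "growth X a (Suc c) - growth X a c = of_bool (lit X (Suc c) a)"
      using less[of c a] Suc growth_sym[OF sX, of a] by simp
    have lit_Suc: "lit X (Suc a) (Suc c) \<longleftrightarrow>
      (lit X (Suc a) c \<or> (Suc a, Suc c) \<in> X \<and> \<not> (\<exists>d\<le>c. (Suc a, d) \<in> skeleton X))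
        \<and> (Suc a, Suc c) \<notin> skeleton X"
      by (auto simp: lit_def le_Suc_eq)
    show ?thesis
    proof (cases "(Suc a, Suc c) \<in> X")
      case True
      have low: "\<not> (\<exists>d\<le>c. (Suc a, d) \<in> X)"
        using fn(1)[OF True] by force
      have noskel: "\<not> (\<exists>d\<le>c. (Suc a, d) \<in> skeleton X)"
      proof
        assume "\<exists>d\<le>c. (Suc a, d) \<in> skeleton X"
        then obtain e where e: "Suc e \<le> c" "growth X a e < growth X (Suc a) e"
          by (auto simp: skeleton_def)
        with less[of a e] Suc have "lit X (Suc a) e" by (auto simp: of_bool_def split: if_splits)
        with e low show False by (auto simp: lit_def)
      qed
      have "\<not> lit X (Suc c) a"
        using fn(1)[OF fn(3)[OF True]] by (force simp: lit_def)
      moreover have "(Suc a, Suc c) \<notin> skeleton X"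
        using True by (auto simp: skeleton_def)
      ultimately show ?thesis
        using True v noskel Suc lit_Suc by simp
    next
      case False
      then have "(Suc a, Suc c) \<in> skeleton X \<longleftrightarrow> lit X (Suc a) c \<and> lit X (Suc c) a"
        using h v by (auto simp: skeleton_def of_bool_def split: if_splits)
      then show ?thesis
        using False h v Suc lit_Suc by (auto simp: of_bool_def split: if_splits)
    qed
  qed
qed

lemma growth_step':
  assumes X: "partial_involution A X"
  shows "growth X a (Suc b) - growth X a b = of_bool (lit X (Suc b) a)"
  using growth_step[OF X, of b a] growth_sym[of X a] X by (simp add: partial_involution_def)

lemma skeleton_iff:
  assumes X: "partial_involution A X"
  shows "(Suc a, Suc b) \<in> skeleton X \<longleftrightarrow>
    (Suc a, Suc b) \<notin> X \<and> lit X (Suc a) b \<and> lit X (Suc b) a"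
  using growth_step[OF X, of a b] growth_step'[OF X, of a b]
  by (auto simp: skeleton_def of_bool_def split: if_splits)

text \<open>Below a skeleton point its column is lit, so the vertical ray that stops there started lower down,
and no ray can stop twice in one column.\<close>

lemma skeleton_D:
  assumes X: "partial_involution A X" and q: "(a, b) \<in> skeleton X"
  obtains d where "d < b" "(a, d) \<in> X" "\<And>e. e < b \<Longrightarrow> (a, e) \<notin> skeleton X"
proof -
  from q obtain a' b' where ab: "a = Suc a'" "b = Suc b'"
    by (auto simp: skeleton_def)
  with q skeleton_iff[OF X] have "lit X a b'" by simp
  with that ab show thesis
    unfolding lit_def using less_Suc_eq_le by blast
qed

lemma partial_involution_skeleton:
  assumes X: "partial_involution A X"
  shows "partial_involution (Domain (skeleton X)) (skeleton X)"
    and "Domain (skeleton X) \<subseteq> A"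
proof -
  show sub: "Domain (skeleton X) \<subseteq> A"
    using skeleton_D[OF X] X by (auto simp: partial_involution_def) blast
  have "b = c" if "(a, b) \<in> skeleton X" "(a, c) \<in> skeleton X" for a b c
    using skeleton_D[OF X that(1)] skeleton_D[OF X that(2)] that
    by (metis linorder_neqE_nat)
  then have "single_valued (skeleton X)" by (auto simp: single_valued_def)
  then show "partial_involution (Domain (skeleton X)) (skeleton X)"
    using X sub sym_skeleton[of X] finite_subset[OF sub]
    by (auto simp: partial_involution_def)
qed

section \<open>Falling chains and the skeleton\<close>

definition falling :: "(nat \<times> nat) list \<Rightarrow> bool" where
  "falling = sorted_wrt (\<lambda>p q. fst p < fst q \<and> snd q < snd p)"

definition falling_bound :: "nat \<Rightarrow> (nat \<times> nat) set \<Rightarrow> bool" where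
  "falling_bound n X \<longleftrightarrow> (\<forall>ps. falling ps \<longrightarrow> set ps \<subseteq> X \<longrightarrow> length ps \<le> n)"

lemma falling_simps [simp]:
  "falling []"
  "falling (p # ps) \<longleftrightarrow> (\<forall>q\<in>set ps. fst p < fst q \<and> snd q < snd p) \<and> falling ps"
  by (auto simp: falling_def)

text \<open>Follow the horizontal ray from the upper left point and the vertical ray from the lower right point.
Either one of them stops before they cross, or they meet and stop at the crossing; in each case
there is a skeleton point in the half-open rectangle. Half-open rectangles make the skeleton points
belonging to consecutive points of a falling chain fall again.\<close>

lemma skeleton_between_points:
  assumes X: "partial_involution A X"
    and p: "(x, y) \<in> X" "(x', y') \<in> X" "x < x'" "y' < y"
  shows "\<exists>a b. (a, b) \<in> skeleton X \<and> x < a \<and> a \<le> x' \<and> y' < b \<and> b \<le> y"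
proof (rule ccontr)
  assume no: "\<nexists>a b. (a, b) \<in> skeleton X \<and> x < a \<and> a \<le> x' \<and> y' < b \<and> b \<le> y"
  note fn = partial_involution_fun[OF X] and sfn = partial_involution_fun[OF partial_involution_skeleton(1)[OF X]]
  obtain a where a: "x' = Suc a" using p(3) by (cases x') auto
  obtain b where b: "y = Suc b" using p(4) by (cases y) auto
  have low: "y' < d" if "(x', d) \<in> skeleton X" for d
    using skeleton_D[OF X that] fn(1)[OF p(2)] by metis
  have left: "x < d" if "(y, d) \<in> skeleton X" for d
    using skeleton_D[OF X that] fn(1)[OF fn(3)[OF p(1)]] by metis
  have "lit X x' b"
    unfolding lit_def using p a b low no by (metis le_SucI less_Suc_eq_le order_refl)
  moreover have "lit X y a"
    unfolding lit_def using p a b left no fn(3) sfn(3)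
    by (metis le_SucI less_Suc_eq_le order_refl)
  moreover have "(x', y) \<notin> X" using fn(2)[OF p(1)] p(3) by auto
  ultimately have "(x', y) \<in> skeleton X" using skeleton_iff[OF X] a b by simp
  then show False using no p by auto
qed

text \<open>The converse, by following rays backwards: without a point of \<open>X\<close> in the rectangle, the vertical
ray stopping at \<open>(a, b)\<close> and the horizontal ray stopping at \<open>(a', b')\<close> would cross at
\<open>(a, b')\<close>, and so they would both have stopped there already.\<close>

lemma point_between_skeleton:
  assumes X: "partial_involution A X"
    and q: "(a, b) \<in> skeleton X" "(a', b') \<in> skeleton X" "a < a'" "b' < b"
  shows "\<exists>x y. (x, y) \<in> X \<and> a \<le> x \<and> x < a' \<and> b' \<le> y \<and> y < b"
proof (rule ccontr)
  assume no: "\<nexists>x y. (x, y) \<in> X \<and> a \<le> x \<and> x < a' \<and> b' \<le> y \<and> y < b"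
  note fn = partial_involution_fun[OF X]
    and sfn = partial_involution_fun[OF partial_involution_skeleton(1)[OF X]]
  obtain d where d: "d < b" "(a, d) \<in> X" using skeleton_D[OF X q(1)] by metis
  obtain c where c: "c < a'" "(b', c) \<in> X" using skeleton_D[OF X sfn(3)[OF q(2)]] by metis
  have d': "d < b'" using no d q by (meson not_le order_refl)
  have c': "c < a" using no c q fn(3) by (meson not_le order_refl)
  obtain e f where ef: "a = Suc e" "b' = Suc f"
    using d' c' by (metis Suc_pred' gr0I not_less0)
  have "lit X a f"
    unfolding lit_def using d d' ef sfn(1)[OF q(1)] q(4)
    by (metis Suc_n_not_le_n less_Suc_eq_le order_less_imp_le order_trans)
  moreover have "lit X b' e"
    unfolding lit_def using c c' ef sfn(1)[OF sfn(3)[OF q(2)]] q(3)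
    by (metis Suc_n_not_le_n less_Suc_eq_le order_less_imp_le order_trans)
  moreover have "(a, b') \<notin> X" using fn(1)[OF d(2)] d' by auto
  ultimately have "(a, b') \<in> skeleton X" using skeleton_iff[OF X] ef by simp
  then show False using sfn(1)[OF q(1)] q(4) by auto
qed

text \<open>One skeleton point for each pair of neighbours in the chain, so one point is lost.\<close>

lemma falling_skeleton_of_points:
  assumes X: "partial_involution A X"
  shows "falling (p # ps) \<Longrightarrow> set (p # ps) \<subseteq> X \<Longrightarrow>
    \<exists>qs. length qs = length ps \<and> falling qs \<and> set qs \<subseteq> skeleton X \<and>
         (\<forall>q\<in>set qs. fst p < fst q \<and> snd q \<le> snd p)"
proof (induction ps arbitrary: p)
  case Nil
  then show ?case by auto
next
  case (Cons p' ps)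
  then obtain qs where qs: "length qs = length ps" "falling qs" "set qs \<subseteq> skeleton X"
    "\<forall>q\<in>set qs. fst p' < fst q \<and> snd q \<le> snd p'"
    by (metis falling_simps(2) list.set_intros(2) set_subset_Cons subset_trans)
  obtain a b where ab: "(a, b) \<in> skeleton X" "fst p < a" "a \<le> fst p'" "snd p' < b" "b \<le> snd p"
    using skeleton_between_points[OF X, of "fst p" "snd p" "fst p'" "snd p'"] Cons.prems by auto
  show ?case
    by (rule exI[of _ "(a, b) # qs"]) (use qs ab Cons.prems in fastforce)
qed

text \<open>One point of \<open>X\<close> for each pair of neighbours, and one more below the last skeleton point. A further
point, to the left of the first skeleton point, is added in the next lemma.\<close>

lemma falling_points_of_skeleton:
  assumes X: "partial_involution A X"
  shows "falling (q # qs) \<Longrightarrow> set (q # qs) \<subseteq> skeleton X \<Longrightarrow>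
    \<exists>ps. length ps = Suc (length qs) \<and> falling ps \<and> set ps \<subseteq> X \<and>
         (\<forall>p\<in>set ps. fst q \<le> fst p \<and> snd p < snd q)"
proof (induction qs arbitrary: q)
  case Nil
  then have "(fst q, snd q) \<in> skeleton X" by simp
  then obtain d where "d < snd q" "(fst q, d) \<in> X" using skeleton_D[OF X] by metis
  then show ?case by (intro exI[of _ "[(fst q, d)]"]) auto
next
  case (Cons q' qs)
  then obtain ps where ps: "length ps = Suc (length qs)" "falling ps" "set ps \<subseteq> X"
    "\<forall>p\<in>set ps. fst q' \<le> fst p \<and> snd p < snd q'"
    by (metis falling_simps(2) list.set_intros(2) set_subset_Cons subset_trans)
  obtain x y where xy: "(x, y) \<in> X" "fst q \<le> x" "x < fst q'" "snd q' \<le> y" "y < snd q"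
    using point_between_skeleton[OF X, of "fst q" "snd q" "fst q'" "snd q'"] Cons.prems by auto
  show ?case
    by (rule exI[of _ "(x, y) # ps"]) (use ps xy Cons.prems in fastforce)
qed

text \<open>The longest falling chain of the skeleton has exactly one element less than that of \<open>X\<close>. This is
the half of Schensted's theorem that concerns decreasing subsequences: each row of the tableau
accounts for one element of the chain.\<close>

lemma falling_bound_skeleton:
  assumes X: "partial_involution A X" and ne: "X \<noteq> {}"
  shows "falling_bound n (skeleton X) \<longleftrightarrow> falling_bound (Suc n) X"
proof
  assume n: "falling_bound n (skeleton X)"
  show "falling_bound (Suc n) X"
    unfolding falling_bound_def
  proof (intro allI impI)
    fix ps assume "falling ps" "set ps \<subseteq> X"
    then show "length ps \<le> Suc n"
      using falling_skeleton_of_points[OF X] n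
      by (cases ps) (auto simp: falling_bound_def simp del: falling_simps, metis)
  qed
next
  assume n: "falling_bound (Suc n) X"
  show "falling_bound n (skeleton X)"
    unfolding falling_bound_def
  proof (intro allI impI)
    fix qs assume qs: "falling qs" "set qs \<subseteq> skeleton X"
    show "length qs \<le> n"
    proof (cases qs)
      case (Cons q qs')
      then obtain ps where ps: "length ps = length qs" "falling ps" "set ps \<subseteq> X"
        "\<forall>p\<in>set ps. fst q \<le> fst p \<and> snd p < snd q"
        using falling_points_of_skeleton[OF X, of q qs'] qs by auto
      note sfn = partial_involution_fun[OF partial_involution_skeleton(1)[OF X]]
      have "(snd q, fst q) \<in> skeleton X" using qs Cons sfn(3) by auto
      then obtain c where c: "c < fst q" "(snd q, c) \<in> X" using skeleton_D[OF X] by metis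
      then have "(c, snd q) \<in> X" using partial_involution_fun(3)[OF X] by simp
      with ps c have "falling ((c, snd q) # ps)" "set ((c, snd q) # ps) \<subseteq> X" by fastforce+
      with n have "length ((c, snd q) # ps) \<le> Suc n" unfolding falling_bound_def by blast
      then show ?thesis using ps(1) by simp
    qed simp
  qed
qed

section \<open>The lead row\<close>

text \<open>The columns whose vertical ray never stops. They form the first row of the Robinson-Schensted tableau
of \<open>X\<close>; the entries of the other rows form the domain of the skeleton.\<close>

definition lead_row :: "(nat \<times> nat) set \<Rightarrow> nat set" where
  "lead_row X = Domain X - Domain (skeleton X)"

text \<open>For disjoint increasing rows, this is the condition that \<open>S\<close> can be placed under \<open>R\<close> in a standard
tableau, in a form that matches \<^const>\<open>growth\<close>.\<close>

definition dominates :: "nat set \<Rightarrow> nat set \<Rightarrow> bool" where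
  "dominates R S \<longleftrightarrow> (\<forall>a. card ({..a} \<inter> S) \<le> card ({..a} \<inter> R))"

lemma growth_mono:
  assumes X: "partial_involution A X"
  shows "growth X a b \<le> growth X (Suc a) b" "growth X a b \<le> growth X a (Suc b)"
  using growth_step[OF X, of a b] growth_step'[OF X, of a b] by (auto simp: of_bool_def split: if_splits)

lemma growth_top_row:
  assumes X: "partial_involution A X" and r: "A \<subseteq> {..r}"
  shows "growth X a r = int (card ({..a} \<inter> lead_row X))"
proof (induction a)
  case 0
  have "0 \<notin> lead_row X" using X by (auto simp: partial_involution_def lead_row_def)
  then have "{..0} \<inter> lead_row X = {}" by auto
  then show ?case by simp
next
  case (Suc a)
  have X_r: "d \<le> r" if "(Suc a, d) \<in> X" for d
    using partial_involution_pos[OF X that] r by auto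
  have sk_r: "d \<le> r" if "(Suc a, d) \<in> skeleton X" for d
    using partial_involution_pos[OF partial_involution_skeleton(1)[OF X] that]
      partial_involution_skeleton(2)[OF X] r by auto
  have "lit X (Suc a) r \<longleftrightarrow> Suc a \<in> lead_row X"
    using X_r sk_r by (auto simp: lit_def lead_row_def)
  moreover have "card ({..Suc a} \<inter> lead_row X)
      = card ({..a} \<inter> lead_row X) + of_bool (Suc a \<in> lead_row X)"
    by (auto simp: atMost_Suc)
  ultimately show ?case
    using growth_step[OF X, of a r] Suc by simp
qed

text \<open>The first part of a partition is at least the second: a skeleton point increases the right-hand
side as well, because a ray enters its square.\<close>

lemma growth_skeleton_le:
  assumes X: "partial_involution A X"
  shows "growth (skeleton X) a b \<le> growth X a b"
proof (induction "skeleton X" a b rule: growth.induct)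
  case (3 a b)
  note m = growth_mono[OF X, of a "Suc b"] growth_mono[OF X, of "Suc a" b]
  show ?case
  proof (cases "(Suc a, Suc b) \<in> skeleton X")
    case True
    then have "growth X a b < growth X (Suc a) b" by (auto simp: skeleton_def)
    then show ?thesis using 3(1) True m by simp
  next
    case False
    then show ?thesis using 3(2,3) m by simp
  qed
qed auto

lemma partial_involution_bounded:
  assumes "partial_involution A X"
  obtains r where "A \<subseteq> {..r}"
proof -
  have "finite A" using assms by (simp add: partial_involution_def)
  then have "A \<subseteq> {..Max A}" by auto
  then show thesis by (rule that)
qed

lemma lead_row_dominates:
  assumes X: "partial_involution A X"
  shows "dominates (lead_row X) (lead_row (skeleton X))"
  unfolding dominates_def
proof
  fix a
  obtain r where r: "A \<subseteq> {..r}" using partial_involution_bounded[OF X] .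
  note sk = partial_involution_skeleton[OF X]
  from growth_skeleton_le[OF X, of a r]
  show "card ({..a} \<inter> lead_row (skeleton X)) \<le> card ({..a} \<inter> lead_row X)"
    using growth_top_row[OF X r, of a] growth_top_row[OF sk(1), of r a] sk(2) r by auto
qed

lemma lead_row_nonempty:
  assumes X: "partial_involution A X" and ne: "X \<noteq> {}"
  shows "lead_row X \<noteq> {}"
proof
  assume R: "lead_row X = {}"
  obtain r where r: "A \<subseteq> {..r}" using partial_involution_bounded[OF X] .
  from ne obtain a b where ab: "(a, b) \<in> X" by auto
  then obtain a' b' where ab': "a = Suc a'" "b = Suc b'"
    using partial_involution_pos[OF X ab] by (meson gr0_implies_Suc)
  have "0 \<le> growth X a' b'"
  proof (induction a')
    case (Suc n)
    then show ?case using growth_mono(1)[OF X, of n b'] by linarith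
  qed simp
  then have "0 < growth X a b" using ab ab' by simp
  also have "b \<le> r" using partial_involution_pos[OF X ab] r by auto
  then have "growth X a b \<le> growth X a r"
    by (rule lift_Suc_mono_le[of "growth X a", OF growth_mono(2)[OF X]])
  finally show False using growth_top_row[OF X r, of a] R by simp
qed

section \<open>Recovering an involution from its lead row and skeleton\<close>

text \<open>The local rule can be run backwards: the lower left corner of a unit square, and whether the square
contains a point of \<open>X\<close>, are determined by the other three corners and the skeleton.\<close>

lemma growth_inverse_rule:
  assumes X: "partial_involution A X"
  shows "growth X a b = (if (Suc a, Suc b) \<in> skeleton X then growth X (Suc a) (Suc b) - 1
           else min (growth X a (Suc b)) (growth X (Suc a) b))"
    and "(Suc a, Suc b) \<in> X \<longleftrightarrow>
           growth X a (Suc b) < growth X (Suc a) (Suc b) \<and>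
           growth X (Suc a) b < growth X (Suc a) (Suc b)"
proof -
  note fn = partial_involution_fun[OF X]
  note h = growth_step[OF X, of a b] and v = growth_step'[OF X, of a b]
    and sk = skeleton_iff[OF X, of a b]
  have "\<not> lit X (Suc a) b" "\<not> lit X (Suc b) a" if "(Suc a, Suc b) \<in> X"
    using fn(1)[OF that] fn(1)[OF fn(3)[OF that]] by (force simp: lit_def)+
  then show "growth X a b = (if (Suc a, Suc b) \<in> skeleton X then growth X (Suc a) (Suc b) - 1
           else min (growth X a (Suc b)) (growth X (Suc a) b))"
    and "(Suc a, Suc b) \<in> X \<longleftrightarrow>
           growth X a (Suc b) < growth X (Suc a) (Suc b) \<and>
           growth X (Suc a) b < growth X (Suc a) (Suc b)"
    using h v sk by (auto simp: of_bool_def split: if_splits)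
qed

text \<open>The backward rule, run from the boundary at \<open>r\<close> with the values prescribed there by the lead row
\<open>R\<close>, for the skeleton \<open>S\<close>. The indices count steps down from \<open>r\<close>, so the value at
\<open>i\<close>, \<open>j\<close> is meant for the corner \<open>(r - i, r - j)\<close>.\<close>

fun retract :: "nat \<Rightarrow> nat set \<Rightarrow> (nat \<times> nat) set \<Rightarrow> nat \<Rightarrow> nat \<Rightarrow> int" where
  "retract r R S 0 j = int (card ({..r - j} \<inter> R))"
| "retract r R S (Suc i) 0 = int (card ({..r - Suc i} \<inter> R))"
| "retract r R S (Suc i) (Suc j) =
     (if (r - i, r - j) \<in> S then retract r R S i j - 1
      else min (retract r R S (Suc i) j) (retract r R S i (Suc j)))"

lemma growth_eq_retract:
  assumes X: "partial_involution A X" and r: "A \<subseteq> {..r}"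
    and ij: "i \<le> r" "j \<le> r"
  shows "growth X (r - i) (r - j) = retract r (lead_row X) (skeleton X) i j"
  using r ij
proof (induction r "lead_row X" "skeleton X" i j rule: retract.induct)
  case (1 r j)
  have "growth X r (r - j) = growth X (r - j) r"
    using growth_sym X by (simp add: partial_involution_def)
  then show ?case using growth_top_row[OF X 1(1)] by simp
next
  case (2 r i)
  then show ?case using growth_top_row[OF X 2(1)] by simp
next
  case (3 r i j)
  then have "Suc (r - Suc i) = r - i" "Suc (r - Suc j) = r - j" by auto
  then show ?case
    using growth_inverse_rule(1)[OF X, of "r - Suc i" "r - Suc j"] 3 by auto
qed

lemma skeleton_lead_row_inject:
  assumes X: "partial_involution A X" and Y: "partial_involution B Y"
    and eq: "lead_row X = lead_row Y" "skeleton X = skeleton Y"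
  shows "X = Y"
proof -
  obtain m n where mn: "A \<subseteq> {..m}" "B \<subseteq> {..n}"
    using partial_involution_bounded[OF X] partial_involution_bounded[OF Y] by metis
  define r where "r = max m n"
  have r: "A \<subseteq> {..r}" "B \<subseteq> {..r}" using mn by (force simp: r_def)+
  have g: "growth X a b = growth Y a b" if "a \<le> r" "b \<le> r" for a b
    using growth_eq_retract[OF X, of r "r - a" "r - b"] growth_eq_retract[OF Y, of r "r - a" "r - b"]
      r that eq by simp
  have "(a, b) \<in> X \<longleftrightarrow> (a, b) \<in> Y" if "0 < a" "0 < b" "a \<le> r" "b \<le> r" for a b
  proof -
    obtain a' b' where "a = Suc a'" "b = Suc b'" using \<open>0 < a\<close> \<open>0 < b\<close> by (meson gr0_implies_Suc)
    then show ?thesis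
      using growth_inverse_rule(2)[OF X, of a' b'] growth_inverse_rule(2)[OF Y, of a' b'] g that
      by (simp del: growth.simps)
  qed
  moreover have "0 < a \<and> 0 < b \<and> a \<le> r \<and> b \<le> r" if "(a, b) \<in> X \<or> (a, b) \<in> Y" for a b
    using that partial_involution_pos[OF X] partial_involution_pos[OF Y] r by blast
  ultimately have "(a, b) \<in> X \<longleftrightarrow> (a, b) \<in> Y" for a b by metis
  then show ?thesis by (intro set_eqI) (metis surj_pair)
qed

lemma retract_sym:
  assumes "sym S"
  shows "retract r R S i j = retract r R S j i"
proof -
  have "(r - i, r - j) \<in> S \<longleftrightarrow> (r - j, r - i) \<in> S" for i j
    using assms by (auto dest: symD)
  moreover have "retract r R S i 0 = retract r R S 0 i" for i
    by (cases i) auto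
  ultimately show ?thesis
    by (induction r R S i j rule: retract.induct) (auto simp: min.commute)
qed

lemma card_atMost_Suc_Int:
  "card ({..Suc a} \<inter> R) = card ({..a} \<inter> R) + of_bool (Suc a \<in> R)"
  by (auto simp: atMost_Suc)

text \<open>Every admissible pair of lead row and skeleton occurs. The backward rule defines a function \<open>L\<close> on
the grid, and \<open>X\<close> is the set of squares that are left by jumps of \<open>L\<close> both to the right and
upwards. It remains to see that \<open>L\<close> is the growth function of \<open>X\<close>. Only the
vanishing of \<open>L\<close> on the axes uses domination: \<open>L\<close> stays above the growth function of
\<open>Y\<close>, so it is nonnegative, and being monotone it is squeezed to zero on the axes.\<close>

lemma skeleton_lead_row_surj:
  assumes Y: "partial_involution B Y" and R: "finite R" "0 \<notin> R" "R \<inter> B = {}"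
    and dom: "dominates R (lead_row Y)"
  obtains X where "partial_involution (R \<union> B) X" "skeleton X = Y" "lead_row X = R"
proof -
  have B: "finite B" "0 \<notin> B" "sym Y" "Domain Y = B" using Y by (auto simp: partial_involution_def)
  note fn = partial_involution_fun[OF Y] and pos = partial_involution_pos[OF Y]
  define r where "r = Max (R \<union> B)"
  have r: "R \<subseteq> {..r}" "B \<subseteq> {..r}" using R(1) B(1) by (auto simp: r_def simp del: Max_ge intro!: Max_ge)
  define L where "L a b = retract r R Y (r - a) (r - b)" for a b
  have L_sym: "L a b = L b a" for a b
    using retract_sym[OF B(3)] by (simp add: L_def)
  have L_top: "L a r = int (card ({..a} \<inter> R))" if "a \<le> r" for a
  proof -
    have "L a r = retract r R Y 0 (r - a)" using retract_sym[OF B(3)] by (simp add: L_def)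
    then show ?thesis using that by simp
  qed
  have L_rec: "L a b = (if (Suc a, Suc b) \<in> Y then L (Suc a) (Suc b) - 1
      else min (L a (Suc b)) (L (Suc a) b))" if "a < r" "b < r" for a b
  proof -
    have e: "r - a = Suc (r - Suc a)" "r - b = Suc (r - Suc b)"
      "r - (r - Suc a) = Suc a" "r - (r - Suc b) = Suc b"
      using that by auto
    show ?thesis unfolding L_def e(1,2) retract.simps e(3,4) by simp
  qed
  \<comment> \<open>All jumps are zero or one, and column \<open>a + 1\<close> has no jump from the height of its point of
    \<open>Y\<close> upwards; the latter keeps the backward rule consistent at points of \<open>Y\<close>.\<close>
  have good: "(L (Suc a) b - L a b = 0 \<or> L (Suc a) b - L a b = 1) \<and>
      ((\<exists>d\<le>b. (Suc a, d) \<in> Y) \<longrightarrow> L (Suc a) b = L a b)" if "a < r" "b \<le> r" for a b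
    using that
  proof (induction "(r - a) + (r - b)" arbitrary: a b rule: less_induct)
    case less
    show ?case
    proof (cases "b = r")
      case True
      have "L (Suc a) b - L a b = of_bool (Suc a \<in> R)"
        using L_top[of "Suc a"] L_top[of a] less True by (simp add: card_atMost_Suc_Int)
      moreover have "Suc a \<notin> R" if "(Suc a, d) \<in> Y" for d
        using pos[OF that] R by auto
      ultimately show ?thesis by (auto simp: of_bool_def split: if_splits)
    next
      case False
      then have b: "b < r" using less by simp
      have h: "(L (Suc a) (Suc b) - L a (Suc b) = 0 \<or> L (Suc a) (Suc b) - L a (Suc b) = 1) \<and>
         ((\<exists>d\<le>Suc b. (Suc a, d) \<in> Y) \<longrightarrow> L (Suc a) (Suc b) = L a (Suc b))"
        using less(1)[of a "Suc b"] less(2) b by simp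
      have v: "(L (Suc a) (Suc b) - L (Suc a) b = 0 \<or> L (Suc a) (Suc b) - L (Suc a) b = 1) \<and>
         ((\<exists>d\<le>Suc a. (Suc b, d) \<in> Y) \<longrightarrow> L (Suc a) (Suc b) = L (Suc a) b)"
        using less(1)[of b "Suc a"] less(2) b by (simp add: L_sym[of "Suc b" "Suc a"] L_sym[of b "Suc a"])
      show ?thesis
      proof (cases "(Suc a, Suc b) \<in> Y")
        case True
        then have "L (Suc a) b = L (Suc a) (Suc b)" using v fn(3) by auto
        moreover have "\<not> (\<exists>d\<le>b. (Suc a, d) \<in> Y)" using fn(1)[OF True] by force
        ultimately show ?thesis using True L_rec[OF less(2) b] by simp
      next
        case False
        then show ?thesis using h v L_rec[OF less(2) b] by (auto simp: min_def le_Suc_eq)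
      qed
    qed
  qed
  have hor: "L (Suc a) b = L a b \<or> L (Suc a) b = L a b + 1" if "a < r" "b \<le> r" for a b
    using good[OF that] by auto
  have flat: "L (Suc a) b = L a b" if "a < r" "b \<le> r" "(Suc a, d) \<in> Y" "d \<le> b" for a b d
    using good[OF that(1,2)] that(3,4) by auto
  have ver: "L a (Suc b) = L a b \<or> L a (Suc b) = L a b + 1" if "b < r" "a \<le> r" for a b
    using hor[OF that] by (simp add: L_sym)
  have flat': "L a (Suc b) = L a b" if "b < r" "a \<le> r" "(d, Suc b) \<in> Y" "d \<le> a" for a b d
    using flat[OF that(1,2) fn(3)[OF that(3)] that(4)] by (simp add: L_sym)

  have above: "growth Y a b \<le> L a b" if "a \<le> r" "b \<le> r" for a b
    using that
  proof (induction "(r - a) + (r - b)" arbitrary: a b rule: less_induct)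
    case less
    have top: "growth Y c r \<le> L c r" if "c \<le> r" for c
      using dom growth_top_row[OF Y r(2), of c] L_top[OF that] by (simp add: dominates_def)
    consider "b = r" | "a = r" | "a < r" "b < r" using less by linarith
    then show ?case
    proof cases
      case 1
      then show ?thesis using top less by simp
    next
      case 2
      then show ?thesis using top[of b] less growth_sym[OF B(3)] L_sym by simp
    next
      case 3
      have "growth Y (Suc a) (Suc b) \<le> L (Suc a) (Suc b)" "growth Y a (Suc b) \<le> L a (Suc b)"
        "growth Y (Suc a) b \<le> L (Suc a) b"
        using 3 by (auto intro!: less(1) simp del: growth.simps)
      then show ?thesis
        using L_rec[OF 3] growth_mono[OF Y, of a b]
        by (cases "(Suc a, Suc b) \<in> Y") auto
    qed
  qed
  have L_0: "L 0 b = 0" if "b \<le> r" for b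
  proof -
    have "{..0} \<inter> R = {}" using R(2) by auto
    then have "L 0 r = 0" using L_top[of 0] by simp
    moreover have "L 0 b \<le> L 0 r"
      using that
    proof (induction "r - b" arbitrary: b)
      case (Suc n)
      then have "L 0 (Suc b) \<le> L 0 r" by simp
      then show ?case using ver[of b 0] Suc by fastforce
    qed simp
    moreover have "0 \<le> L 0 b" using above[of 0 b] that by simp
    ultimately show ?thesis by simp
  qed

  define X where "X = {(Suc a, Suc b) | a b. a < r \<and> b < r \<and>
      L a (Suc b) < L (Suc a) (Suc b) \<and> L (Suc a) b < L (Suc a) (Suc b)}"
  have X_iff: "(Suc a, Suc b) \<in> X \<longleftrightarrow>
      L a (Suc b) < L (Suc a) (Suc b) \<and> L (Suc a) b < L (Suc a) (Suc b)"
    if "a < r" "b < r" for a b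
    using that by (auto simp: X_def)
  have disj: "p \<notin> Y" if pX: "p \<in> X" for p
  proof -
    obtain a b where p: "p = (Suc a, Suc b)" "a < r" "b < r"
      "L a (Suc b) < L (Suc a) (Suc b)" using pX by (auto simp: X_def)
    then show ?thesis using flat[of a "Suc b" "Suc b"] by auto
  qed
  have symX: "sym X" using L_sym by (auto simp: sym_def X_def)
  \<comment> \<open>Going up in a column, a jump can appear only at a point of \<open>X\<close> and disappear only at a point of
    \<open>Y\<close>.\<close>
  have rise: "(Suc a, Suc b) \<in> X" if "a < r" "b < r" "L a (Suc b) < L (Suc a) (Suc b)"
      "L a b = L (Suc a) b" for a b
    using that hor[of a b] ver[of b a] ver[of b "Suc a"] flat[of a "Suc b" "Suc b"] L_rec[of a b] X_iff[of a b]
    by (auto simp: min_def split: if_splits)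
  have fall: "(Suc a, Suc b) \<in> Y" if "a < r" "b < r" "L a (Suc b) = L (Suc a) (Suc b)"
      "L a b < L (Suc a) b" for a b
    using that ver[of b "Suc a"] L_rec[of a b] by (auto simp: min_def split: if_splits)
  have X_step: "L (Suc a) b = L a b" if "(Suc a, Suc b) \<in> X" for a b
    using that disj[OF that] L_rec[of a b] hor[of a "Suc b"] ver[of b "Suc a"]
    by (auto simp: X_def)
  \<comment> \<open>A column with a jump at height \<open>b\<close> keeps it up to height \<open>c\<close>, unless it meets a point of
    \<open>Y\<close> in between.\<close>
  have stay: "L a c < L (Suc a) c \<or> (\<exists>d. b < d \<and> d \<le> c \<and> (Suc a, d) \<in> Y)"
    if "a < r" "b \<le> c" "c \<le> r" "L a b < L (Suc a) b" for a b c
    using that(2,3)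
  proof (induction c rule: dec_induct)
    case (step n)
    then show ?case
      using fall[of a n] hor[of a "Suc n"] that(1) by (metis Suc_le_lessD Suc_leD le_SucI le_imp_less_Suc lessI order_refl zless_add1_eq)
  qed (use that in auto)
  \<comment> \<open>Since \<open>L\<close> vanishes on the axis, every jump has started at some point of \<open>X\<close>.\<close>
  have start: "\<exists>d. 0 < d \<and> d \<le> b \<and> (Suc a, d) \<in> X"
    if "a < r" "b \<le> r" "L a b < L (Suc a) b" for a b
    using that(2,3)
  proof (induction b)
    case 0
    then show ?case using L_0 L_sym that(1) by (metis Suc_leI less_imp_le_nat less_irrefl)
  next
    case (Suc b)
    then show ?case using rise[of a b] hor[of a b] that(1)
      by (metis Suc_le_lessD Suc_leD le_SucI zero_less_Suc order_refl zless_add1_eq)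
  qed
  have fnX: "b = c" if "(a, b) \<in> X" "(a, c) \<in> X" for a b c
  proof -
    have False if ab: "(a, b) \<in> X" and ac: "(a, c) \<in> X" and "b < c" for a b c
    proof -
      obtain a' c' where a': "a = Suc a'" "c = Suc c'" "a' < r" "c' < r"
        using ac by (auto simp: X_def)
      have "L a' b < L a b" "b \<le> r" using that(1) a' by (auto simp: X_def)
      then have "\<exists>d. b < d \<and> d \<le> c' \<and> (a, d) \<in> Y"
        using stay[of a' b c'] a' X_step[of a' c'] that by auto
      then show False
        using flat[of a' c] a' that(2) by (force simp: X_def)
    qed
    then show ?thesis using that by (metis linorder_neqE_nat)
  qed
  have domX: "Domain X = R \<union> B"
  proof
    show "Domain X \<subseteq> R \<union> B"
    proof
      fix a assume "a \<in> Domain X"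
      then obtain b where ab: "(a, b) \<in> X" by auto
      then obtain a' where a': "a = Suc a'" "a' < r" "b \<le> r" "L a' b < L a b"
        using ab by (auto simp: X_def)
      with stay[of a' b r] have "L a' r < L a r \<or> a \<in> B" using B(4) by auto
      then show "a \<in> R \<union> B"
        using L_top[of a'] L_top[of a] a' by (auto simp: card_atMost_Suc_Int split: if_splits)
    qed
    show "R \<union> B \<subseteq> Domain X"
    proof
      fix a assume a: "a \<in> R \<union> B"
      then have "0 < a" using R(2) B(2) by (auto intro!: gr0I)
      then obtain a' where a': "a = Suc a'" "a' < r" using a r by (cases a) auto
      have "\<exists>b\<le>r. L a' b < L a b"
      proof (cases "a \<in> R")
        case True
        then show ?thesis using L_top[of a'] L_top[of a] a'
          by (intro exI[of _ r]) (simp add: card_atMost_Suc_Int)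
      next
        case False
        with a obtain b where b: "(a, b) \<in> Y" using B(4) by auto
        then obtain b' where b': "b = Suc b'" "b' < r"
          using pos[OF b] r by (cases b) auto
        then have "L a' b' < L a b'"
          using L_rec[of a' b'] a' b flat[of a' b b] flat'[of b' a a] by auto
        with b'(2) show ?thesis by (intro exI[of _ b']) simp
      qed
      then show "a \<in> Domain X" using start[of a'] a' by blast
    qed
  qed
  have piX: "partial_involution (R \<union> B) X"
    unfolding partial_involution_def using R B symX fnX domX by (auto simp: single_valued_def)

  have growth_X: "growth X a b = L a b" if "a \<le> r" "b \<le> r" for a b
    using that
  proof (induction a arbitrary: b)
    case 0
    then show ?case using L_0 by simp
  next
    case (Suc a)
    have a: "a < r" using Suc by simp
    show ?case
      using Suc.prems(2)
    proof (induction b)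
      case 0
      then show ?case using L_0[of "Suc a"] L_sym[of "Suc a" 0] a by simp
    next
      case (Suc b)
      have b: "b < r" using Suc by simp
      have IH: "growth X a b = L a b" "growth X a (Suc b) = L a (Suc b)"
          "growth X (Suc a) b = L (Suc a) b"
        using Suc.IH Suc.prems \<open>\<And>b. a \<le> r \<Longrightarrow> b \<le> r \<Longrightarrow> growth X a b = L a b\<close> a by auto
      show ?case
      proof (cases "(Suc a, Suc b) \<in> X")
        case True
        then show ?thesis
          using IH(1) X_step[OF True] ver[of b "Suc a"] X_iff[OF a b] a b by auto
      next
        case False
        then show ?thesis
          using IH(2,3) hor[of a "Suc b"] ver[of b "Suc a"] X_iff[OF a b] a b by auto
      qed
    qed
  qed
  have "skeleton X = Y"
  proof -
    have inside: "(Suc a, Suc b) \<in> skeleton X \<longleftrightarrow> (Suc a, Suc b) \<in> Y" if "a < r" "b < r" for a b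
    proof -
      have "(Suc a, Suc b) \<in> skeleton X \<longleftrightarrow>
          (Suc a, Suc b) \<notin> X \<and> L a b < L (Suc a) b \<and> L a b < L a (Suc b)"
        using growth_X[of a b] growth_X[of "Suc a" b] growth_X[of a "Suc b"] that
        by (simp add: skeleton_def del: growth.simps)
      also have "\<dots> \<longleftrightarrow> (Suc a, Suc b) \<in> Y"
        using L_rec[OF that] disj[of "(Suc a, Suc b)"] flat[of a "Suc b" "Suc b"]
          flat'[of b "Suc a" "Suc a"] that
        by auto
      finally show ?thesis .
    qed
    have "(a, b) \<in> skeleton X \<longleftrightarrow> (a, b) \<in> Y" for a b
    proof (cases "0 < a \<and> 0 < b \<and> a \<le> r \<and> b \<le> r")
      case True
      then obtain a' b' where "a = Suc a'" "b = Suc b'" by (meson gr0_implies_Suc)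
      then show ?thesis using inside[of a' b'] True by simp
    next
      case False
      then show ?thesis
        using pos[of a b] r partial_involution_pos[OF partial_involution_skeleton(1)[OF piX], of a b]
          partial_involution_skeleton(2)[OF piX] by blast
    qed
    then show ?thesis by (intro set_eqI) (metis surj_pair)
  qed
  moreover have "lead_row X = R"
    using calculation domX B(4) R(3) by (auto simp: lead_row_def)
  ultimately show thesis using that piX by blast
qed

section \<open>Involutions and standard tableaux\<close>

text \<open>The entries may form any set, as removing the first row of a standard Young tableau leaves a tableau
whose entries are no initial segment.\<close>

definition tableau :: "nat set \<Rightarrow> nat list list \<Rightarrow> bool" where
  "tableau A t \<longleftrightarrow>
     [] \<notin> set t \<and>
     sorted_wrt (\<ge>) (map length t) \<and>
     distinct (concat t) \<and> set (concat t) = A \<and>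
     (\<forall>row \<in> set t. sorted_wrt (<) row) \<and>
     (\<forall>i j. Suc i < length t \<and> j < length (t ! Suc i) \<longrightarrow> t ! i ! j < t ! Suc i ! j)"

lemma standard_young_tableau_eq: "standard_young_tableau r = tableau {1..r}"
  by (intro ext) (simp only: standard_young_tableau_def tableau_def)

definition fits :: "nat list \<Rightarrow> nat list \<Rightarrow> bool" where
  "fits R S \<longleftrightarrow> length S \<le> length R \<and> (\<forall>j < length S. R ! j < S ! j)"

lemma tableau_Nil [simp]: "tableau A [] \<longleftrightarrow> A = {}"
  by (auto simp: tableau_def)

text \<open>Rows weakly decrease in length and columns increase as soon as this holds for the first two rows and
for the tableau below the first row.\<close>

lemma tableau_Cons:
  "tableau A (R # t) \<longleftrightarrow> R \<noteq> [] \<and> sorted_wrt (<) R \<and> set R \<subseteq> A \<and> tableau (A - set R) t \<and>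
     (t \<noteq> [] \<longrightarrow> fits R (hd t))"
proof -
  have lengths: "sorted_wrt (\<ge>) (map length (R # t)) \<longleftrightarrow>
      sorted_wrt (\<ge>) (map length t) \<and> (t \<noteq> [] \<longrightarrow> length (hd t) \<le> length R)"
    by (cases t) auto
  have entries: "distinct (concat (R # t)) \<and> set (concat (R # t)) = A \<and> Q \<longleftrightarrow>
      distinct R \<and> set R \<subseteq> A \<and> distinct (concat t) \<and> set (concat t) = A - set R \<and> Q" for Q
    by auto
  have all_nat: "(\<forall>i. P i) \<longleftrightarrow> P 0 \<and> (\<forall>i. P (Suc i))" for P
    by (metis nat.exhaust)
  have "(\<forall>i j. Suc i < length (R # t) \<and> j < length ((R # t) ! Suc i) \<longrightarrow>
        (R # t) ! i ! j < (R # t) ! Suc i ! j) \<longleftrightarrow>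
      (\<forall>i j. i < length t \<and> j < length (t ! i) \<longrightarrow> (R # t) ! i ! j < t ! i ! j)"
    by simp
  also have "\<dots> \<longleftrightarrow> (t \<noteq> [] \<longrightarrow> (\<forall>j < length (hd t). R ! j < hd t ! j)) \<and>
      (\<forall>i j. Suc i < length t \<and> j < length (t ! Suc i) \<longrightarrow> t ! i ! j < t ! Suc i ! j)"
    using all_nat[of "\<lambda>i. \<forall>j. i < length t \<and> j < length (t ! i) \<longrightarrow> (R # t) ! i ! j < t ! i ! j"]
    by (auto simp: hd_conv_nth)
  finally have columns: "(\<forall>i j. Suc i < length (R # t) \<and> j < length ((R # t) ! Suc i) \<longrightarrow>
        (R # t) ! i ! j < (R # t) ! Suc i ! j) \<longleftrightarrow>
      (t \<noteq> [] \<longrightarrow> (\<forall>j < length (hd t). R ! j < hd t ! j)) \<and>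
      (\<forall>i j. Suc i < length t \<and> j < length (t ! Suc i) \<longrightarrow> t ! i ! j < t ! Suc i ! j)" .
  show ?thesis
    unfolding tableau_def fits_def lengths entries columns
    using strict_sorted_iff[of R] by (simp only: list.set(2) insert_iff ball_simps(7)) blast
qed

text \<open>The entries up to \<open>a\<close> form an initial segment of an increasing row; this translates between
positions in a row and counts of its entries.\<close>

lemma less_card_atMost_iff:
  assumes "sorted_wrt (<) R"
  shows "j < card ({..a} \<inter> set R) \<longleftrightarrow> j < length R \<and> R ! j \<le> (a::nat)"
  using assms
proof (induction R arbitrary: j)
  case (Cons x R)
  show ?case
  proof (cases "x \<le> a")
    case True
    then have "{..a} \<inter> set (x # R) = insert x ({..a} \<inter> set R)" "x \<notin> {..a} \<inter> set R"
      using Cons.prems by auto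
    then have "card ({..a} \<inter> set (x # R)) = Suc (card ({..a} \<inter> set R))" by simp
    then show ?thesis using Cons True by (cases j) auto
  next
    case False
    then have "{..a} \<inter> set (x # R) = {}" using Cons.prems by auto
    moreover have "a < (x # R) ! j" if "j < length (x # R)"
      using that False Cons.prems by (cases j) (auto dest!: nth_mem)
    ultimately show ?thesis by (auto simp: not_le)
  qed
qed simp

lemma fits_iff_dominates:
  assumes R: "sorted_wrt (<) R" and S: "sorted_wrt (<) S" and disj: "set R \<inter> set S = {}"
  shows "fits R S \<longleftrightarrow> dominates (set R) (set S)"
proof
  assume f: "fits R S"
  show "dominates (set R) (set S)"
    unfolding dominates_def
  proof (intro allI leI notI)
    fix a assume "card ({..a} \<inter> set R) < card ({..a} \<inter> set S)"
    then show False
      using f less_card_atMost_iff[OF R, of "card ({..a} \<inter> set R)" a]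
        less_card_atMost_iff[OF S, of "card ({..a} \<inter> set R)" a]
      by (fastforce simp: fits_def)
  qed
next
  assume d: "dominates (set R) (set S)"
  have "j < length R \<and> R ! j < S ! j" if j: "j < length S" for j
  proof -
    have "j < card ({..S ! j} \<inter> set S)" using j less_card_atMost_iff[OF S] by simp
    also have "\<dots> \<le> card ({..S ! j} \<inter> set R)" using d by (simp add: dominates_def)
    finally have "j < length R" "R ! j \<le> S ! j" using less_card_atMost_iff[OF R] by auto
    moreover have "R ! j \<noteq> S ! j" using disj calculation(1) j by (metis disjoint_iff nth_mem)
    ultimately show ?thesis by simp
  qed
  then show "fits R S" unfolding fits_def by (metis leI less_irrefl)
qed

text \<open>The rows of the Robinson-Schensted tableau. The recursion is cut off after \<open>n\<close> rows, which makes it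
primitive; no row is lost if falling chains have at most \<open>n\<close> elements.\<close>

primrec rows :: "nat \<Rightarrow> (nat \<times> nat) set \<Rightarrow> nat list list" where
  "rows 0 X = []"
| "rows (Suc n) X =
     (if X = {} then [] else sorted_list_of_set (lead_row X) # rows n (skeleton X))"

lemma falling_bound_0 [simp]: "falling_bound 0 X \<longleftrightarrow> X = {}"
proof
  assume b: "falling_bound 0 X"
  show "X = {}"
  proof (rule ccontr)
    assume "X \<noteq> {}"
    then obtain p where "p \<in> X" by auto
    then have "falling [p]" "set [p] \<subseteq> X" by auto
    with b have "length [p] \<le> 0" unfolding falling_bound_def by blast
    then show False by simp
  qed
qed (auto simp: falling_bound_def)

lemma falling_bound_empty [simp]: "falling_bound n {}"
  by (auto simp: falling_bound_def)

lemma partial_involution_empty [simp]: "partial_involution A {} \<longleftrightarrow> A = {}"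
  by (auto simp: partial_involution_def)

lemma rows_nonempty:
  assumes "falling_bound n X" "X \<noteq> {}"
  shows "\<exists>t. rows n X = sorted_list_of_set (lead_row X) # t"
  using assms by (cases n) auto

lemma rows_empty [simp]: "rows n {} = []"
  by (cases n) auto

lemma finite_lead_row:
  assumes "partial_involution A X"
  shows "finite (lead_row X)" "lead_row X \<subseteq> A" "A - lead_row X = Domain (skeleton X)"
proof -
  show "finite (lead_row X)" "lead_row X \<subseteq> A"
    using assms by (auto simp: lead_row_def partial_involution_def)
  show "A - lead_row X = Domain (skeleton X)"
    using assms partial_involution_skeleton(2)[OF assms] by (auto simp: lead_row_def partial_involution_def)
qed

lemma tableau_rows:
  "partial_involution A X \<Longrightarrow> falling_bound n X \<Longrightarrow> tableau A (rows n X) \<and> length (rows n X) \<le> n"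
proof (induction n arbitrary: A X)
  case (Suc n)
  show ?case
  proof (cases "X = {}")
    case False
    note X = Suc.prems(1) and sk = partial_involution_skeleton[OF Suc.prems(1)]
    have bound: "falling_bound n (skeleton X)" using falling_bound_skeleton[OF X False] Suc.prems by simp
    note IH = Suc.IH[OF sk(1) bound]
    note fin = finite_lead_row[OF X]
    have "fits (sorted_list_of_set (lead_row X)) (hd (rows n (skeleton X)))" if "rows n (skeleton X) \<noteq> []"
    proof -
      have "skeleton X \<noteq> {}" using that by auto
      then obtain t where t: "rows n (skeleton X) = sorted_list_of_set (lead_row (skeleton X)) # t"
        using rows_nonempty[OF bound] by auto
      have "lead_row X \<inter> lead_row (skeleton X) = {}" by (auto simp: lead_row_def)
      then show ?thesis
        using t lead_row_dominates[OF X] fin finite_lead_row[OF sk(1)]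
        by (subst fits_iff_dominates) auto
    qed
    then show ?thesis
      using False IH fin lead_row_nonempty[OF X False] by (auto simp: tableau_Cons)
  qed (use Suc in auto)
qed auto

lemma rows_inject:
  "partial_involution A X \<Longrightarrow> partial_involution B Y \<Longrightarrow> falling_bound n X \<Longrightarrow> falling_bound n Y \<Longrightarrow>
    rows n X = rows n Y \<Longrightarrow> X = Y"
proof (induction n arbitrary: A B X Y)
  case (Suc n)
  show ?case
  proof (cases "X = {} \<or> Y = {}")
    case True
    then show ?thesis using Suc.prems(5) by (auto split: if_splits)
  next
    case False
    note X = Suc.prems(1) and Y = Suc.prems(2)
    have "sorted_list_of_set (lead_row X) = sorted_list_of_set (lead_row Y)"
      and r: "rows n (skeleton X) = rows n (skeleton Y)"
      using False Suc.prems(5) by auto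
    then have "lead_row X = lead_row Y"
      using finite_lead_row(1)[OF X] finite_lead_row(1)[OF Y] by (metis set_sorted_list_of_set)
    moreover have "skeleton X = skeleton Y"
      using Suc.IH[OF partial_involution_skeleton(1)[OF X] partial_involution_skeleton(1)[OF Y] _ _ r]
        falling_bound_skeleton[OF X] falling_bound_skeleton[OF Y] False Suc.prems by simp
    ultimately show ?thesis using skeleton_lead_row_inject[OF X Y] by simp
  qed
qed auto

lemma rows_surj:
  "tableau A t \<Longrightarrow> 0 \<notin> A \<Longrightarrow> length t \<le> n \<Longrightarrow>
    \<exists>X. partial_involution A X \<and> falling_bound n X \<and> rows n X = t"
proof (induction n arbitrary: A t)
  case (Suc n)
  show ?case
  proof (cases t)
    case Nil
    then show ?thesis using Suc.prems by (intro exI[of _ "{}"]) simp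
  next
    case (Cons R u)
    then have t: "R \<noteq> []" "sorted_wrt (<) R" "set R \<subseteq> A" "tableau (A - set R) u"
        "u \<noteq> [] \<longrightarrow> fits R (hd u)"
      using Suc.prems by (auto simp: tableau_Cons)
    then obtain Y where Y: "partial_involution (A - set R) Y" "falling_bound n Y" "rows n Y = u"
      using Suc.IH[OF t(4)] Suc.prems Cons by auto
    have "dominates (set R) (lead_row Y)"
    proof (cases "Y = {}")
      case True
      then show ?thesis by (simp add: dominates_def lead_row_def)
    next
      case False
      then have "fits R (sorted_list_of_set (lead_row Y))"
        using rows_nonempty[OF Y(2)] Y(3) t(5) by auto
      then show ?thesis
        using t(2) finite_lead_row[OF Y(1)] by (subst (asm) fits_iff_dominates) auto
    qed
    then obtain X where X: "partial_involution (set R \<union> (A - set R)) X" "skeleton X = Y" "lead_row X = set R"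
      using skeleton_lead_row_surj[OF Y(1), of "set R"] Suc.prems(2) t(3) by auto
    have ne: "X \<noteq> {}" using X(3) t(1) by (auto simp: lead_row_def)
    have "sorted_list_of_set (set R) = R"
      using t(2) by (simp add: strict_sorted_iff sorted_list_of_set.idem_if_sorted_distinct)
    moreover have "set R \<union> (A - set R) = A" using t(3) by auto
    ultimately show ?thesis
      using X Y ne Cons falling_bound_skeleton[OF X(1) ne] by (intro exI[of _ X]) auto
  qed
qed auto

text \<open>The Robinson-Schensted correspondence for involutions, with Schensted's theorem: tableaux with at most
\<open>n\<close> rows correspond to involutions without falling chains of more than \<open>n\<close> points.\<close>

theorem card_tableaux_eq_card_partial_involutions:
  assumes "0 \<notin> A"
  shows "card {t. tableau A t \<and> length t \<le> n} = card {X. partial_involution A X \<and> falling_bound n X}"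
proof -
  have "bij_betw (rows n) {X. partial_involution A X \<and> falling_bound n X}
      {t. tableau A t \<and> length t \<le> n}"
    unfolding bij_betw_def
  proof
    show "inj_on (rows n) {X. partial_involution A X \<and> falling_bound n X}"
      by (rule inj_onI) (metis (mono_tags) mem_Collect_eq rows_inject)
    show "rows n ` {X. partial_involution A X \<and> falling_bound n X} = {t. tableau A t \<and> length t \<le> n}"
      using tableau_rows rows_surj[OF _ assms] by (auto simp: image_iff) metis
  qed
  then show ?thesis by (simp add: bij_betw_same_card)
qed

section \<open>Transposition of tableaux\<close>

lemma mset_concat_transpose: "mset (concat (List.transpose xss)) = mset (concat xss)"
proof (induction xss rule: List.transpose.induct)
  case (3 x xs xss)
  have split: "mset (concat yss) = mset (concat (map (case_list [] (\<lambda>h t. [h])) yss))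
      + mset (concat (concat (map (case_list [] (\<lambda>h t. [t])) yss)))" for yss :: "'a list list"
  proof (induction yss)
    case (Cons ys yss)
    then show ?case by (cases ys) simp_all
  qed simp
  show ?case
    by (simp only: List.transpose.simps concat.simps append_Cons mset.simps mset_append 3 split[of xss])
      (simp add: ac_simps)
qed simp_all

text \<open>The filter in column \<open>i\<close> selects the rows longer than \<open>i\<close>. Since row lengths decrease, these
are the top rows, so that position \<open>j\<close> in the column is row \<open>j\<close> of the tableau.\<close>

lemma tableau_transpose:
  assumes t: "tableau A t"
  shows "tableau A (List.transpose t)"
proof -
  have sorted: "sorted (rev (map length t))"
    using t by (simp add: tableau_def sorted_wrt_rev)
  define col where "col i = filter (\<lambda>row. i < length row) t" for i
  have col: "List.transpose t ! i = map (\<lambda>row. row ! i) (col i)" if "i < length (List.transpose t)" for i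
    using nth_transpose[OF that] by (simp add: col_def)
  have col_nth: "col i ! j = t ! j" "j < length t" "i < length (t ! j)" if "j < length (col i)" for i j
  proof -
    have tw: "col i = takeWhile (\<lambda>row. i < length row) t"
      unfolding col_def by (rule filter_equals_takeWhile_sorted_rev[OF sorted])
    show nth: "col i ! j = t ! j" using that takeWhile_nth by (simp add: tw)
    have "length (col i) \<le> length t" by (simp add: col_def)
    then show "j < length t" using that by simp
    show "i < length (t ! j)"
      using that nth_mem[OF that] nth by (simp add: col_def)
  qed
  have col_mono: "length (col (Suc i)) \<le> length (col i)" for i
    unfolding col_def length_filter_conv_card by (intro card_mono) auto
  have "mset (concat (List.transpose t)) = mset (concat t)" by (rule mset_concat_transpose)
  then have "distinct (concat (List.transpose t))" "set (concat (List.transpose t)) = A"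
    using t mset_eq_setD mset_eq_imp_distinct_iff unfolding tableau_def by metis+
  moreover have "[] \<notin> set (List.transpose t)"
  proof
    assume "[] \<in> set (List.transpose t)"
    then obtain i where i: "i < length (List.transpose t)" "List.transpose t ! i = []"
      by (metis in_set_conv_nth)
    then have "t \<noteq> []" "i < length (t ! 0)"
      using length_transpose_sorted[OF sorted] by (auto split: if_splits)
    then have "t ! 0 \<in> set (col i)" by (simp add: col_def)
    then show False using i col by auto
  qed
  moreover have "sorted_wrt (\<ge>) (map length (List.transpose t))"
    using sorted_transpose[of t] by (simp only: sorted_wrt_rev)
  moreover have "sorted_wrt (<) row" if row: "row \<in> set (List.transpose t)" for row
  proof -
    obtain i where i: "i < length (List.transpose t)" "row = List.transpose t ! i"
      using row by (auto simp: in_set_conv_nth)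
    have "row ! j < row ! Suc j" if "Suc j < length row" for j
    proof -
      have j: "Suc j < length (col i)" using that i col by simp
      then have "t ! j ! i < t ! Suc j ! i"
        using t col_nth[OF j] unfolding tableau_def by blast
      then show ?thesis using i col j col_nth[OF j] col_nth(1)[of j i] by simp
    qed
    then show ?thesis by (intro sorted_wrt_iff_nth_Suc_transp[THEN iffD2]) auto
  qed
  moreover have "List.transpose t ! i ! j < List.transpose t ! Suc i ! j"
    if i: "Suc i < length (List.transpose t)" and "j < length (List.transpose t ! Suc i)" for i j
  proof -
    have j: "j < length (col (Suc i))" using that col by simp
    then have j': "j < length (col i)" using col_mono[of i] by simp
    have "sorted_wrt (<) (t ! j)" using t col_nth(2)[OF j] by (simp add: tableau_def)
    then have "t ! j ! i < t ! j ! Suc i" using col_nth(3)[OF j] sorted_wrt_nth_less by blast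
    then show ?thesis using i col j j' col_nth(1)[OF j] col_nth(1)[OF j'] by simp
  qed
  ultimately show ?thesis unfolding tableau_def by blast
qed

lemma card_tableaux_transpose:
  "card {t. tableau A t \<and> (\<forall>row\<in>set t. length row \<le> k)} = card {t. tableau A t \<and> length t \<le> k}"
proof -
  have twice: "List.transpose (List.transpose t) = t" if "tableau A t" for t
  proof -
    have "sorted (rev (map length t))"
      using that by (simp add: tableau_def sorted_wrt_rev)
    moreover have "takeWhile (\<lambda>row. row \<noteq> []) t = t"
      using that by (auto simp: tableau_def takeWhile_eq_all_conv)
    ultimately show ?thesis by (simp add: List.transpose_transpose)
  qed
  have len: "length (List.transpose t) \<le> k \<longleftrightarrow> (\<forall>row\<in>set t. length row \<le> k)" for t :: "nat list list"
    by (induction t) (auto simp: length_transpose)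
  show ?thesis
    by (rule bij_betw_same_card[of List.transpose], rule bij_betw_byWitness[where f' = List.transpose])
      (use twice len tableau_transpose in \<open>auto simp flip: len\<close>)
qed

section \<open>Fixed point-free involutions\<close>

text \<open>The graphs of the involutions counted by \<^const>\<open>x_num\<close>, on an arbitrary support.\<close>

definition matchings :: "nat \<Rightarrow> nat set \<Rightarrow> (nat \<times> nat) set set" where
  "matchings k A = {X. partial_involution A X \<and> irrefl X \<and> falling_bound k X}"

definition graph_on :: "nat set \<Rightarrow> (nat \<Rightarrow> nat) \<Rightarrow> (nat \<times> nat) set" where
  "graph_on A v = (\<lambda>i. (i, v i)) ` A"

lemma decreasing_subsequence_imp_falling:
  assumes "decreasing_subsequence s r v"
  shows "\<exists>ps. falling ps \<and> set ps \<subseteq> graph_on {1..r} v \<and> length ps = length s"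
proof -
  obtain N where N: "s = map v (nths [1..<Suc r] N)"
    using assms unfolding decreasing_subsequence_def word_def subseq_conv_nths nths_map by blast
  define t where "t = nths [1..<Suc r] N"
  have "sorted t" "distinct t"
    unfolding t_def by (auto intro!: sorted_nths distinct_nthsI simp del: upt_Suc)
  then have t: "sorted_wrt (<) t" by (simp add: strict_sorted_iff)
  have "sorted_wrt (\<lambda>i j. v j < v i) t"
    using assms N by (simp add: decreasing_subsequence_def t_def sorted_wrt_map)
  with t have "falling (map (\<lambda>i. (i, v i)) t)"
    by (simp add: falling_def sorted_wrt_map sorted_wrt_iff_nth_less)
  moreover have "set t \<subseteq> {1..r}" using set_nths_subset[of "[1..<Suc r]" N] by (auto simp: t_def)
  ultimately show ?thesis
    using N by (intro exI[of _ "map (\<lambda>i. (i, v i)) t"]) (auto simp: graph_on_def t_def)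
qed

lemma falling_imp_decreasing_subsequence:
  assumes "falling ps" "set ps \<subseteq> graph_on {1..r} v"
  shows "decreasing_subsequence (map snd ps) r v"
proof -
  define t where "t = map fst ps"
  have snd: "map snd ps = map v t"
    using assms(2) by (auto simp: graph_on_def t_def)
  have t: "sorted_wrt (<) t" "sorted_wrt (>) (map v t)"
    using assms(1) unfolding snd[symmetric]
    by (simp_all add: falling_def t_def sorted_wrt_map sorted_wrt_iff_nth_less)
  have "set t \<subseteq> {1..r}" using assms(2) by (auto simp: graph_on_def t_def)
  then have "set (filter (\<lambda>i. i \<in> set t) [1..<Suc r]) = set t" by auto
  then have "filter (\<lambda>i. i \<in> set t) [1..<Suc r] = t"
    using t(1) by (intro strict_sorted_equal) (auto simp: strict_sorted_iff sorted_wrt_filter simp del: upt_Suc)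
  then have "subseq t [1..<Suc r]" by (metis subseq_filter_left)
  then show ?thesis
    unfolding decreasing_subsequence_def word_def snd using t(2) by (simp add: subseq_map del: upt_Suc)
qed

lemma falling_bound_graph_on:
  "falling_bound k (graph_on {1..r} v) \<longleftrightarrow>
     (\<forall>s. decreasing_subsequence s r v \<longrightarrow> length s \<le> k)"
  unfolding falling_bound_def
  using decreasing_subsequence_imp_falling falling_imp_decreasing_subsequence by (metis length_map)

lemma x_num_eq_card_matchings: "x_num k r = card (matchings k {1..r})"
proof -
  let ?V = "{v. involution r v \<and> fixed_point_free r v \<and>
                (\<forall>s. decreasing_subsequence s r v \<longrightarrow> length s \<le> k)}"
  have "bij_betw (graph_on {1..r}) ?V (matchings k {1..r})"
    unfolding bij_betw_def
  proof
    show "inj_on (graph_on {1..r}) ?V"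
    proof (rule inj_onI)
      fix v w assume v: "v \<in> ?V" and w: "w \<in> ?V" and eq: "graph_on {1..r} v = graph_on {1..r} w"
      have "v i = w i" for i
      proof (cases "i \<in> {1..r}")
        case True
        then show ?thesis using eq by (auto simp: graph_on_def set_eq_iff image_iff)
      next
        case False
        then show ?thesis using v w by (auto simp: involution_def permutes_def)
      qed
      then show "v = w" by auto
    qed
    show "graph_on {1..r} ` ?V = matchings k {1..r}"
    proof
      show "graph_on {1..r} ` ?V \<subseteq> matchings k {1..r}"
      proof
        fix X assume "X \<in> graph_on {1..r} ` ?V"
        then obtain v where v: "v \<in> ?V" and X: "X = graph_on {1..r} v" by auto
        have perm: "v permutes {1..r}" and inv: "v (v i) = i" for i
          using v by (auto simp: involution_def fun_eq_iff)
        have "sym X"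
          using perm inv permutes_in_image[OF perm] by (auto simp: sym_def X graph_on_def image_iff)
        moreover have "irrefl X" using v by (auto simp: irrefl_def X graph_on_def fixed_point_free_def)
        ultimately show "X \<in> matchings k {1..r}"
          using v falling_bound_graph_on[of k r v]
          by (auto simp: matchings_def partial_involution_def X graph_on_def single_valued_def Domain_unfold)
      qed
      show "matchings k {1..r} \<subseteq> graph_on {1..r} ` ?V"
      proof
        fix X assume X: "X \<in> matchings k {1..r}"
        then have pi: "partial_involution {1..r} X" by (simp add: matchings_def)
        define v where "v i = (if i \<in> {1..r} then THE j. (i, j) \<in> X else i)" for i
        have v: "(i, v i) \<in> X" if i: "i \<in> {1..r}" for i
        proof -
          have "i \<in> Domain X" using i pi unfolding partial_involution_def by blast
          then obtain j where "(i, j) \<in> X" by blast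
          moreover from this have "(THE j. (i, j) \<in> X) = j"
            using partial_involution_fun(1)[OF pi] by blast
          ultimately show ?thesis using i by (simp add: v_def)
        qed
        have v_in: "v i \<in> {1..r}" if "i \<in> {1..r}" for i
          using partial_involution_pos(2)[OF pi v[OF that]] .
        have vv: "v (v i) = i" for i
        proof (cases "i \<in> {1..r}")
          case True
          then show ?thesis
            using partial_involution_fun(1,3)[OF pi] v[OF True] v[OF v_in[OF True]] by blast
        qed (auto simp: v_def)
        have out: "v i = i" if "i \<notin> {1..r}" for i using that by (auto simp: v_def)
        have "v permutes {1..r}"
          unfolding permutes_def using vv out by metis
        then have "involution r v" using vv by (auto simp: involution_def fun_eq_iff)
        moreover have "fixed_point_free r v"
          using X v by (fastforce simp: fixed_point_free_def matchings_def irrefl_def)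
        moreover have g: "graph_on {1..r} v = X"
        proof
          show "graph_on {1..r} v \<subseteq> X" using v by (auto simp: graph_on_def)
          show "X \<subseteq> graph_on {1..r} v"
          proof (rule subrelI)
            fix i j assume ij: "(i, j) \<in> X"
            then have "i \<in> {1..r}" using partial_involution_pos(1)[OF pi] by blast
            moreover from this have "j = v i" using v partial_involution_fun(1)[OF pi ij] by blast
            ultimately show "(i, j) \<in> graph_on {1..r} v" by (simp add: graph_on_def)
          qed
        qed
        ultimately show "X \<in> graph_on {1..r} ` ?V"
          using X falling_bound_graph_on[of k r v] by (auto simp: matchings_def intro!: image_eqI[of _ _ v])
      qed
    qed
  qed
  then show ?thesis by (simp add: x_num_def bij_betw_same_card)
qed

lemma finite_matchings:
  assumes "finite A"
  shows "finite (matchings k A)"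
proof (rule finite_subset)
  show "matchings k A \<subseteq> Pow (A \<times> A)"
    using partial_involution_pos by (auto simp: matchings_def)
  show "finite (Pow (A \<times> A))" using assms by simp
qed

text \<open>An order embedding of the support reflects falling chains. The inequality is applied in both
directions to relabel a support by an initial segment.\<close>

lemma card_matchings_image_le:
  fixes e :: "nat \<Rightarrow> nat"
  assumes A: "finite A" and e: "strict_mono_on A e" and 0: "0 \<notin> e ` A"
  shows "card (matchings k A) \<le> card (matchings k (e ` A))"
proof (rule card_inj_on_le)
  have inj: "inj_on e A" using e by (rule strict_mono_on_imp_inj_on)
  have sub: "X \<subseteq> A \<times> A" if "X \<in> matchings k A" for X
    using that partial_involution_pos by (auto simp: matchings_def)
  show "finite (matchings k (e ` A))" using A by (simp add: finite_matchings)
  show "inj_on ((`) (map_prod e e)) (matchings k A)"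
    using inj_on_image_Pow[OF map_prod_inj_on[OF inj inj]] sub by (auto intro: inj_on_subset)
  show "(`) (map_prod e e) ` matchings k A \<subseteq> matchings k (e ` A)"
  proof (rule image_subsetI)
    fix X assume X: "X \<in> matchings k A"
    then have pi: "partial_involution A X" and "irrefl X" and b: "falling_bound k X"
      by (auto simp: matchings_def)
    let ?Y = "map_prod e e ` X"
    have "sym ?Y" using partial_involution_fun(3)[OF pi] by (fastforce simp: sym_def)
    moreover have "single_valued ?Y"
      using partial_involution_fun(1)[OF pi] partial_involution_pos[OF pi] inj
      by (auto simp: single_valued_def inj_on_eq_iff)
    moreover have "Domain ?Y = e ` A"
      using pi by (force simp: partial_involution_def)
    moreover have "irrefl ?Y"
      using \<open>irrefl X\<close> partial_involution_pos[OF pi] inj by (fastforce simp: irrefl_def inj_on_eq_iff)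
    moreover have "falling_bound k ?Y"
      unfolding falling_bound_def
    proof (intro allI impI)
      fix ps assume ps: "falling ps" "set ps \<subseteq> ?Y"
      then have "ps \<in> map (map_prod e e) ` lists X"
        using lists_image[of "map_prod e e" X] by auto
      then obtain qs where qs: "ps = map (map_prod e e) qs" "set qs \<subseteq> X" by auto
      have "e a < e b \<longleftrightarrow> a < b" if "a \<in> A" "b \<in> A" for a b
        using strict_mono_on_less[OF e that] .
      then have "falling qs"
        using ps(1) qs sub[OF X] unfolding falling_def
        by (auto simp: sorted_wrt_map subset_iff elim!: sorted_wrt_mono_rel[rotated]) blast+
      with qs b show "length ps \<le> k" by (auto simp: falling_bound_def)
    qed
    ultimately show "?Y \<in> matchings k (e ` A)"
      using A 0 by (auto simp: matchings_def partial_involution_def)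
  qed
qed

lemma ex_strict_mono_on_image:
  fixes A B :: "nat set"
  assumes "finite A" "finite B" "card A = card B"
  obtains e where "strict_mono_on A e" "e ` A = B"
proof -
  obtain f where f: "bij_betw f {..<card A} A" "strict_mono_on {..<card A} f"
    using ex_bij_betw_strict_mono_card[OF assms(1)] .
  obtain g where g: "bij_betw g {..<card A} B" "strict_mono_on {..<card A} g"
    using ex_bij_betw_strict_mono_card[OF assms(2)] assms(3) by auto
  define h where "h = inv_into {..<card A} f"
  have h: "h a \<in> {..<card A}" "f (h a) = a" if "a \<in> A" for a
    using that f(1) inv_into_into[of a f "{..<card A}"] f_inv_into_f[of a f "{..<card A}"]
    by (auto simp: h_def bij_betw_def)
  have "strict_mono_on A (g \<circ> h)"
  proof (rule strict_mono_onI)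
    fix a b assume "a \<in> A" "b \<in> A" "a < b"
    then have "h a < h b" using h strict_mono_on_less[OF f(2), of "h a" "h b"] by auto
    then show "(g \<circ> h) a < (g \<circ> h) b"
      using h \<open>a \<in> A\<close> \<open>b \<in> A\<close> strict_mono_onD[OF g(2)] by simp
  qed
  moreover have "(g \<circ> h) ` A = B"
    using bij_betw_imp_surj_on[OF bij_betw_inv_into[OF f(1)]] bij_betw_imp_surj_on[OF g(1)]
    by (simp only: image_comp[symmetric] h_def)
  ultimately show thesis by (rule that)
qed

lemma card_matchings:
  assumes "finite A" "0 \<notin> A"
  shows "card (matchings k A) = x_num k (card A)"
proof -
  let ?B = "{1..card A}"
  obtain e where e: "strict_mono_on A e" "e ` A = ?B"
    using ex_strict_mono_on_image[of A ?B] assms by auto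
  obtain f where f: "strict_mono_on ?B f" "f ` ?B = A"
    using ex_strict_mono_on_image[of ?B A] assms by auto
  have "card (matchings k A) \<le> card (matchings k ?B)"
    using card_matchings_image_le[OF assms(1) e(1)] e(2) by simp
  moreover have "card (matchings k ?B) \<le> card (matchings k A)"
    using card_matchings_image_le[OF _ f(1)] f(2) assms(2) by simp
  ultimately show ?thesis by (simp add: x_num_eq_card_matchings)
qed

section \<open>Fixed points do not matter for odd bounds\<close>

lemma falling_append:
  "falling (ps @ qs) \<longleftrightarrow>
     falling ps \<and> falling qs \<and> (\<forall>p\<in>set ps. \<forall>q\<in>set qs. fst p < fst q \<and> snd q < snd p)"
  by (auto simp: falling_def sorted_wrt_append)

text \<open>In a falling chain, of two points the one further left is the higher one.\<close>

lemma falling_compare: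
  assumes "falling ps" "p \<in> set ps" "q \<in> set ps" "fst p \<le> fst q"
  shows "snd q \<le> snd p"
  using assms by (induction ps) fastforce+

text \<open>A falling chain strictly above the diagonal can be continued by its own mirror image: the chain lies
to the left of and above every point of the image.\<close>

lemma falling_mirror:
  assumes "falling ps" and above: "\<forall>p\<in>set ps. fst p < snd p"
  shows "falling (ps @ rev (map prod.swap ps))"
proof -
  have "falling (rev (map prod.swap ps))"
    using assms(1) by (auto simp: falling_def sorted_wrt_rev sorted_wrt_map elim!: sorted_wrt_mono_rel[rotated])
  moreover have "fst p < snd q \<and> fst q < snd p" if "p \<in> set ps" "q \<in> set ps" for p q
    using falling_compare[OF assms(1) that] falling_compare[OF assms(1) that(2,1)] above that
    by (cases "fst p \<le> fst q") fastforce+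
  ultimately show ?thesis using assms(1) by (auto simp: falling_append)
qed

lemma falling_filter: "falling ps \<Longrightarrow> falling (filter P ps)"
  by (simp add: falling_def sorted_wrt_filter)

lemma falling_mirror_below:
  assumes "falling ps" and "\<forall>p\<in>set ps. snd p < fst p"
  shows "falling (rev (map prod.swap ps) @ ps)"
proof -
  let ?qs = "rev (map prod.swap ps)"
  have "falling ?qs"
    using assms(1) by (auto simp: falling_def sorted_wrt_rev sorted_wrt_map elim!: sorted_wrt_mono_rel[rotated])
  moreover have "\<forall>p\<in>set ?qs. fst p < snd p" using assms(2) by auto
  ultimately have "falling (?qs @ rev (map prod.swap ?qs))" by (rule falling_mirror)
  then show ?thesis by (simp add: rev_map)
qed

text \<open>A falling chain has at most one point on the diagonal. If it has \<open>u\<close> points above and \<open>d\<close>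
points below, then mirroring the larger part gives a falling chain of \<open>2 * max u d\<close> points off the
diagonal. If such chains have at most \<open>k = 2 * m + 1\<close> points, then parity gives
\<open>u \<le> m\<close> and \<open>d \<le> m\<close>, which leaves room for the diagonal point. For even \<open>k\<close> there
would be no such room.\<close>

lemma falling_bound_remove_fixed_points:
  assumes X: "sym X" and k: "odd k"
  shows "falling_bound k (X - Id) \<longleftrightarrow> falling_bound k X"
proof
  assume b: "falling_bound k (X - Id)"
  obtain m where m: "k = 2 * m + 1" using k by (auto elim: oddE)
  show "falling_bound k X"
    unfolding falling_bound_def
  proof (intro allI impI)
    fix ps assume ps: "falling ps" "set ps \<subseteq> X"
    define up where "up = filter (\<lambda>p. fst p < snd p) ps"
    define diag where "diag = filter (\<lambda>p. fst p = snd p) ps"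
    define down where "down = filter (\<lambda>p. snd p < fst p) ps"
    have len: "length ps = length up + length diag + length down"
      unfolding up_def diag_def down_def by (induction ps) auto
    have diag1: "length diag \<le> 1"
    proof (rule ccontr)
      assume "\<not> length diag \<le> 1"
      then obtain p q qs where f: "diag = p # q # qs"
        by (metis One_nat_def Suc_le_mono le0 length_Cons list.exhaust list.size(3))
      moreover have "falling diag" "\<forall>p\<in>set diag. fst p = snd p"
        using ps(1) by (auto simp: diag_def falling_filter)
      ultimately show False by fastforce
    qed
    have "length (up @ rev (map prod.swap up)) \<le> k"
    proof -
      have "falling (up @ rev (map prod.swap up))"
        using ps(1) by (intro falling_mirror) (auto simp: up_def falling_filter)
      moreover have "set (up @ rev (map prod.swap up)) \<subseteq> X - Id"
        using ps(2) X by (auto simp: up_def dest: symD)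
      ultimately show ?thesis using b unfolding falling_bound_def by blast
    qed
    moreover have "length (rev (map prod.swap down) @ down) \<le> k"
    proof -
      have "falling (rev (map prod.swap down) @ down)"
        using ps(1) by (intro falling_mirror_below) (auto simp: down_def falling_filter)
      moreover have "set (rev (map prod.swap down) @ down) \<subseteq> X - Id"
        using ps(2) X by (auto simp: down_def dest: symD)
      ultimately show ?thesis using b unfolding falling_bound_def by blast
    qed
    ultimately have "2 * length up \<le> 2 * m + 1" "2 * length down \<le> 2 * m + 1"
      using m by simp_all
    then have "length up \<le> m" "length down \<le> m" by arith+
    then show "length ps \<le> k" using len diag1 m by linarith
  qed
qed (auto simp: falling_bound_def)

lemma falling_bound_add_fixed_points:
  assumes "sym Y" "irrefl Y" "odd k"
  shows "falling_bound k (Y \<union> Id_on B) \<longleftrightarrow> falling_bound k Y"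
proof -
  have "(Y \<union> Id_on B) - Id = Y" using assms(2) by (auto simp: irrefl_def)
  moreover have "sym (Y \<union> Id_on B)" using assms(1) by (auto simp: sym_def)
  ultimately show ?thesis using falling_bound_remove_fixed_points assms(3) by metis
qed

text \<open>An involution is a fixed point-free involution on the complement of its fixed points; by the previous
lemmas the bound on falling chains concerns the fixed point-free part alone.\<close>

lemma card_partial_involutions_by_support:
  assumes A: "finite A" "0 \<notin> A" and k: "odd k"
  shows "card {X. partial_involution A X \<and> falling_bound k X} = (\<Sum>B\<in>Pow A. card (matchings k B))"
proof -
  let ?S = "SIGMA B:Pow A. matchings k B"
  let ?I = "{X. partial_involution A X \<and> falling_bound k X}"
  define join where "join p = snd p \<union> Id_on (A - fst p)" for p :: "nat set \<times> (nat \<times> nat) set"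
  define split where "split X = (Domain (X - Id), X - Id)" for X :: "(nat \<times> nat) set"
  have 1: "split (join (B, Y)) = (B, Y)" "join (B, Y) \<in> ?I" if B: "B \<subseteq> A" and Y: "Y \<in> matchings k B" for B Y
  proof -
    have pi: "partial_involution B Y" "irrefl Y" "falling_bound k Y"
      using Y by (auto simp: matchings_def)
    have J: "join (B, Y) = Y \<union> Id_on (A - B)" by (simp add: join_def)
    have "Y \<union> Id_on (A - B) - Id = Y" using pi(2) by (auto simp: irrefl_def)
    then show "split (join (B, Y)) = (B, Y)"
      using pi(1) by (simp add: split_def J partial_involution_def)
    have "falling_bound k (join (B, Y))"
      unfolding J using falling_bound_add_fixed_points[OF _ pi(2) k] pi
      by (simp add: partial_involution_def)
    moreover have "single_valued (join (B, Y))"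
      using partial_involution_fun(1)[OF pi(1)] partial_involution_pos(1)[OF pi(1)]
      by (auto simp: J single_valued_def)
    moreover have "sym (join (B, Y))"
      using pi(1) by (auto simp: J partial_involution_def sym_def)
    moreover have "Domain (join (B, Y)) = A"
      using pi(1) B by (simp add: J partial_involution_def Domain_Un_eq Domain_Id_on) blast
    ultimately show "join (B, Y) \<in> ?I" using A by (simp add: partial_involution_def)
  qed
  have 2: "join (split X) = X" "split X \<in> ?S" if "X \<in> ?I" for X
  proof -
    have pi: "partial_involution A X" "falling_bound k X" using that by auto
    have fp: "x \<in> A \<and> x \<notin> Domain (X - Id) \<longleftrightarrow> (x, x) \<in> X" for x
      using pi(1) partial_involution_fun(1)[OF pi(1), of x x] by (auto simp: partial_involution_def)
    then show "join (split X) = X" by (auto simp: join_def split_def Id_on_def)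
    have "partial_involution (Domain (X - Id)) (X - Id)"
      using pi(1) A by (auto simp: partial_involution_def sym_def single_valued_def intro: finite_subset[of _ A])
    then show "split X \<in> ?S"
      using pi falling_bound_remove_fixed_points[of X k] k
      by (auto simp: split_def matchings_def irrefl_def partial_involution_def)
  qed
  have "bij_betw join ?S ?I"
  proof (rule bij_betw_byWitness[where f' = split])
    show "join ` ?S \<subseteq> ?I" using 1(2) by blast
    show "split ` ?I \<subseteq> ?S" using 2(2) by blast
  qed (use 1(1) 2(1) in blast)+
  then have "card ?I = card ?S" by (simp add: bij_betw_same_card)
  also have "\<dots> = (\<Sum>B\<in>Pow A. card (matchings k B))"
    using A by (intro card_SigmaI) (auto intro: finite_matchings finite_subset)
  finally show ?thesis .
qed

section \<open>Counting\<close>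

lemma sum_Pow_card:
  fixes f :: "nat \<Rightarrow> nat"
  assumes "finite A"
  shows "(\<Sum>B\<in>Pow A. f (card B)) = (\<Sum>j\<le>card A. (card A choose j) * f j)"
proof -
  have "(\<Sum>B\<in>Pow A. f (card B)) = (\<Sum>j\<le>card A. \<Sum>B\<in>{B \<in> Pow A. card B = j}. f (card B))"
    using assms by (intro sum.group[symmetric]) (auto intro: card_mono)
  also have "\<dots> = (\<Sum>j\<le>card A. (card A choose j) * f j)"
  proof (rule sum.cong)
    fix j
    have "(\<Sum>B\<in>{B \<in> Pow A. card B = j}. f (card B)) = card {B \<in> Pow A. card B = j} * f j" by simp
    then show "(\<Sum>B\<in>{B \<in> Pow A. card B = j}. f (card B)) = (card A choose j) * f j"
      using n_subsets[OF assms, of j] by simp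
  qed simp
  finally show ?thesis .
qed

text \<open>In terms of exponential generating functions, \<open>Y(z) = exp z * X(z)\<close>.\<close>

theorem y_num_binomial_transform:
  assumes "odd k"
  shows "y_num k r = (\<Sum>j\<le>r. (r choose j) * x_num k j)"
proof -
  have "y_num k r = card {X. partial_involution {1..r} X \<and> falling_bound k X}"
    by (simp add: y_num_def standard_young_tableau_eq card_tableaux_transpose
        card_tableaux_eq_card_partial_involutions)
  also have "\<dots> = (\<Sum>B\<in>Pow {1..r}. card (matchings k B))"
    using assms by (intro card_partial_involutions_by_support) auto
  also have "\<dots> = (\<Sum>B\<in>Pow {1..r}. x_num k (card B))"
    by (intro sum.cong card_matchings) (auto intro: finite_subset)
  finally show ?thesis by (simp add: sum_Pow_card)
qed

text \<open>The points above the diagonal and those below it are mirror images of each other, and together they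
are as many as the elements of the support.\<close>

lemma x_num_odd:
  assumes "odd r"
  shows "x_num k r = 0"
proof -
  have "even r" if X: "X \<in> matchings k {1..r}" for X
  proof -
    have pi: "partial_involution {1..r} X" and irr: "irrefl X" using X by (auto simp: matchings_def)
    let ?U = "{p \<in> X. fst p < snd p}" and ?D = "{p \<in> X. snd p < fst p}"
    have fin: "finite X"
      by (rule finite_subset[of _ "{1..r} \<times> {1..r}"]) (use partial_involution_pos[OF pi] in auto)
    have "r = card (Domain X)" using pi by (simp add: partial_involution_def)
    also have "\<dots> = card X"
      unfolding Domain_fst using partial_involution_fun(1)[OF pi]
      by (intro card_image) (auto simp: inj_on_def)
    also have "X = ?U \<union> ?D" using irr by (auto simp: irrefl_def) (metis linorder_neqE_nat)
    also have "card (?U \<union> ?D) = card ?U + card ?D"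
      using fin by (intro card_Un_disjoint) auto
    also have "?D = prod.swap ` ?U"
      using partial_involution_fun(3)[OF pi] by (force simp: image_iff)
    also have "card (prod.swap ` ?U) = card ?U" by (intro card_image) (auto simp: inj_on_def)
    finally show "even r" by simp
  qed
  with assms have "matchings k {1..r} = {}" by auto
  then show ?thesis by (simp add: x_num_eq_card_matchings)
qed

text \<open>Since \<open>X\<close> is even, \<open>Y(- z) = exp (- z) * X(z)\<close>, so \<open>Y(- z) * Y(z) = X(z) * X(z)\<close>; the
two sides are the coefficients of these products.\<close>

lemma alternating_convolution_of_binomial_transform:
  fixes x y :: "nat \<Rightarrow> int"
  assumes y: "\<And>r. y r = (\<Sum>j\<le>r. int (r choose j) * x j)" and x: "\<And>r. odd r \<Longrightarrow> x r = 0"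
  shows "(\<Sum>r=0..N. int (N choose r) * x r * x (N - r)) =
    (\<Sum>r=0..N. (-1) ^ r * int (N choose r) * y r * y (N - r))"
proof -
  define egf where "egf f = Abs_fps (\<lambda>r. real_of_int (f r) / fact r)" for f :: "nat \<Rightarrow> int"
  have egf_mult: "fact N * fps_nth (egf f * egf g) N =
      real_of_int (\<Sum>r=0..N. int (N choose r) * f r * g (N - r))" for f g
    by (simp add: egf_def fps_mult_nth sum_distrib_left binomial_fact field_simps)
  have Y: "egf y = fps_exp 1 * egf x"
  proof (rule fps_ext)
    fix r
    have "fps_nth (egf x * fps_exp 1) r = real_of_int (y r) / fact r"
      unfolding fps_mult_nth
      by (simp add: y egf_def sum_divide_distrib binomial_fact atLeast0AtMost field_simps)
    then show "fps_nth (egf y) r = fps_nth (fps_exp 1 * egf x) r" by (simp add: egf_def mult.commute)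
  qed
  have Y': "egf (\<lambda>r. (-1) ^ r * y r) = fps_exp (-1) * egf x"
  proof (rule fps_ext)
    fix r
    have "(-1) ^ r * x j = (-1) ^ (r - j) * x j" if "j \<le> r" for j
      using x[of j] that by (cases "even j") (auto simp: uminus_power_if)
    then have "(-1) ^ r * y r = (\<Sum>j\<le>r. int (r choose j) * ((-1) ^ (r - j) * x j))"
      unfolding y sum_distrib_left by (intro sum.cong) (auto simp: ac_simps)
    then have "fps_nth (egf x * fps_exp (-1)) r = real_of_int ((-1) ^ r * y r) / fact r"
      unfolding fps_mult_nth
      by (simp add: egf_def sum_divide_distrib binomial_fact atLeast0AtMost field_simps)
    then show "fps_nth (egf (\<lambda>r. (-1) ^ r * y r)) r = fps_nth (fps_exp (-1) * egf x) r"
      by (simp add: egf_def mult.commute)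
  qed
  have "egf (\<lambda>r. (-1) ^ r * y r) * egf y = (fps_exp (-1) * fps_exp 1) * (egf x * egf x)"
    unfolding Y Y' by (simp only: ac_simps)
  also have "fps_exp (-1) * fps_exp 1 = (1 :: real fps)"
    by (simp flip: fps_exp_add_mult)
  finally have "egf (\<lambda>r. (-1) ^ r * y r) * egf y = egf x * egf x" by simp
  then have "real_of_int (\<Sum>r=0..N. int (N choose r) * x r * x (N - r)) =
    real_of_int (\<Sum>r=0..N. int (N choose r) * ((-1) ^ r * y r) * y (N - r))"
    using egf_mult[of x x] egf_mult[of "\<lambda>r. (-1) ^ r * y r" y] by metis
  then show ?thesis by (simp only: of_int_eq_iff) (simp add: ac_simps)
qed

theorem theorem3:
  fixes n k :: nat
  assumes "n > 0" and "k > 0" and "odd k"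
  shows "(\<Sum>r=0..2*n. int ((2*n) choose r) * int (x_num k r) * int (x_num k (2*n - r))) =
         (\<Sum>r=0..2*n. (-1)^r * int ((2*n) choose r) * int (y_num k r) * int (y_num k (2*n - r)))"
  by (rule alternating_convolution_of_binomial_transform)
    (simp_all add: y_num_binomial_transform[OF \<open>odd k\<close>] x_num_odd)

end
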